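(* Let $p\ge1$ and $n\ge2p$ be integers. Then for all $\beta>0$ and all $U,\widetilde U\in\mathrm{St}(n,p)$, $$\widehat m_\beta\big(\|\widetilde U-U\|_{\mathrm F}\big)\le d_\beta(\widetilde U,U)\le\widehat M_\beta\big(\|\widetilde U-U\|_{\mathrm F}\big),$$ where, for $\delta\in[0,2\sqrt p]$, $$\widehat m_\beta(\delta)=\min\{1,\sqrt\beta\}\,2\sqrt p\,\arcsin\left(\frac{\delta}{2\sqrt p}\right),\qquad \widehat M_\beta(\delta)=\max\{1,\sqrt\beta\}\begin{cases}2\arcsin\left(\frac{\delta}{2}\right)&\text{if }\delta\le2,\\ \frac{\pi}{2}\delta&\text{otherwise.}\end{cases}$$
   Context: The Stiefel manifold is $\mathrm{St}(n,p)=\{U\in\mathbb{R}^{n\times p} : U^TU=I_p\}$, with tangent space $T_U\mathrm{St}(n,p)=\{\Delta\in\mathbb{R}^{n\times p} : U^T\Delta+\Delta^TU=0\}$; $\|\cdot\|_{\mathrm F}$ is the Frobenius norm. For $\beta>0$ the $\beta$-metric is $\langle\Delta,\widetilde\Delta\rangle_\beta=\mathrm{Tr}\big(\Delta^T(I_n-(1-\beta)UU^T)\widetilde\Delta\big)$ for $\Delta,\widetilde\Delta\in T_U\mathrm{St}(n,p)$, with norm $\|\Delta\|_\beta=\sqrt{\langle\Delta,\Delta\rangle_\beta}$. The length of a continuously differentiable curve $\gamma:[0,1]\to\mathrm{St}(n,p)$ is $l_\beta(\gamma)=\int_0^1\|\dot\gamma(t)\|_\beta\,dt$, and the geodesic $\beta$-distance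 is $d_\beta(U,\widetilde U)=\inf\{l_\beta(\gamma) : \gamma(0)=U,\ \gamma(1)=\widetilde U\}$, the infimum being over continuously differentiable curves in $\mathrm{St}(n,p)$. *)

theory Defs
  imports "HOL-Analysis.Analysis"
begin

text \<open>
  An n-by-p real matrix has type \<open>real^'p^'n\<close>, with n = CARD('n) and p = CARD('p); in
  particular p is at least 1. The library norm of this type is the Frobenius norm.
\<close>

lemma norm_eq_frobenius:
  fixes A :: "real^'p^'n"
  shows "norm A = sqrt (trace (transpose A ** A))"
proof -
  have "A \<bullet> A = trace (transpose A ** A)"
    unfolding inner_vec_def trace_def matrix_matrix_mult_def transpose_def
    by (simp, rule sum.swap)
  then show ?thesis
    by (simp add: norm_eq_sqrt_inner)
qed

definition stiefel :: "(real^'p^'n) set" where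
  "stiefel = {U. transpose U ** U = mat 1}"

definition tangent_space :: "real^'p^'n \<Rightarrow> (real^'p^'n) set" where
  "tangent_space U = {D. transpose U ** D + transpose D ** U = 0}"

text \<open>
  The metric at the base point \<open>U\<close> is meant for \<open>D\<close> and \<open>E\<close> in \<open>tangent_space U\<close>; the formula
  makes sense for all matrices. It is only applied to velocities of curves in the Stiefel manifold,
  which are tangent by \<open>velocity_in_tangent_space\<close> below.
\<close>

definition beta_inner :: "real \<Rightarrow> real^'p^'n \<Rightarrow> real^'p^'n \<Rightarrow> real^'p^'n \<Rightarrow> real" where
  "beta_inner \<beta> U D E =
     trace (transpose D ** (mat 1 - (1 - \<beta>) *\<^sub>R (U ** transpose U)) ** E)"

definition beta_norm :: "real \<Rightarrow> real^'p^'n \<Rightarrow> real^'p^'n \<Rightarrow> real" where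
  "beta_norm \<beta> U D = sqrt (beta_inner \<beta> U D D)"

text \<open>
  Curves are total functions on the reals of which only the values on \<open>{0..1}\<close> matter;
  derivatives at the endpoints are therefore one-sided.
\<close>

definition velocity :: "(real \<Rightarrow> 'a::real_normed_vector) \<Rightarrow> real \<Rightarrow> 'a" where
  "velocity \<gamma> t = vector_derivative \<gamma> (at t within {0..1})"

definition C1_curve :: "(real \<Rightarrow> 'a::real_normed_vector) \<Rightarrow> bool" where
  "C1_curve \<gamma> \<longleftrightarrow>
     \<gamma> differentiable_on {0..1} \<and> continuous_on {0..1} (velocity \<gamma>)"

definition stiefel_curves :: "(real \<Rightarrow> real^'p^'n) set" where
  "stiefel_curves = {\<gamma>. C1_curve \<gamma> \<and> (\<forall>t\<in>{0..1}. \<gamma> t \<in> stiefel)}"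

lemma velocity_in_tangent_space:
  fixes \<gamma> :: "real \<Rightarrow> real^'p^'n"
  assumes "\<gamma> \<in> stiefel_curves" and t: "t \<in> {0..1}"
  shows "velocity \<gamma> t \<in> tangent_space (\<gamma> t)"
proof -
  let ?F = "at t within {0..1::real}"
  have "\<gamma> differentiable ?F"
    using assms by (auto simp: stiefel_curves_def C1_curve_def differentiable_on_def)
  then have d: "(\<gamma> has_vector_derivative velocity \<gamma> t) ?F"
    unfolding velocity_def by (simp add: vector_derivative_works)
  have comp: "((\<lambda>s. \<gamma> s $ k $ i) has_real_derivative velocity \<gamma> t $ k $ i) ?F" for k i
    using bounded_linear.has_vector_derivative[OF bounded_linear_vec_nth
        bounded_linear.has_vector_derivative[OF bounded_linear_vec_nth d, of k], of i]
    by (simp add: has_real_derivative_iff_has_vector_derivative)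
  have "(transpose (\<gamma> t) ** velocity \<gamma> t + transpose (velocity \<gamma> t) ** \<gamma> t) $ i $ j = 0" for i j
  proof -
    let ?f = "\<lambda>s. \<Sum>k\<in>UNIV. \<gamma> s $ k $ i * \<gamma> s $ k $ j"
    have 1: "(?f has_real_derivative
        (\<Sum>k\<in>UNIV. velocity \<gamma> t $ k $ i * \<gamma> t $ k $ j + velocity \<gamma> t $ k $ j * \<gamma> t $ k $ i)) ?F"
      by (intro DERIV_sum DERIV_mult comp)
    have f: "?f s = (mat 1 :: real^'p^'p) $ i $ j" if "s \<in> {0..1}" for s
    proof -
      have "transpose (\<gamma> s) ** \<gamma> s = mat 1"
        using assms(1) that by (auto simp: stiefel_curves_def stiefel_def)
      then have "(transpose (\<gamma> s) ** \<gamma> s) $ i $ j = (mat 1 :: real^'p^'p) $ i $ j" by simp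
      then show ?thesis by (simp add: matrix_matrix_mult_def transpose_def)
    qed
    have 2: "(?f has_vector_derivative 0) ?F"
      by (rule has_vector_derivative_transform[OF t f has_vector_derivative_const])
    have "(\<Sum>k\<in>UNIV. velocity \<gamma> t $ k $ i * \<gamma> t $ k $ j + velocity \<gamma> t $ k $ j * \<gamma> t $ k $ i) = 0"
      using vector_derivative_unique_within[OF _
          1[unfolded has_real_derivative_iff_has_vector_derivative]
          2] t
      by (auto simp: trivial_limit_within islimpt_Icc)
    then show ?thesis
      by (simp add: matrix_matrix_mult_def transpose_def sum.distrib mult.commute add.commute)
  qed
  then show ?thesis
    by (simp add: tangent_space_def vec_eq_iff)
qed

definition beta_length :: "real \<Rightarrow> (real \<Rightarrow> real^'p^'n) \<Rightarrow> real" where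
  "beta_length \<beta> \<gamma> = integral {0..1} (\<lambda>t. beta_norm \<beta> (\<gamma> t) (velocity \<gamma> t))"

text \<open>
  The infimum is taken in the extended reals, so that it is \<open>\<infinity>\<close> if no curve joins the two points.
\<close>

definition beta_dist :: "real \<Rightarrow> real^'p^'n \<Rightarrow> real^'p^'n \<Rightarrow> ereal" where
  "beta_dist \<beta> U V =
     (INF \<gamma> \<in> {\<gamma> \<in> stiefel_curves. \<gamma> 0 = U \<and> \<gamma> 1 = V}. ereal (beta_length \<beta> \<gamma>))"

text \<open>
  Both bounds are meant for \<open>\<delta>\<close> between 0 and \<open>2 * sqrt p\<close>, a range which contains the Frobenius
  distance of any two points of the Stiefel manifold.
\<close>

definition m_hat :: "nat \<Rightarrow> real \<Rightarrow> real \<Rightarrow> real" where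
  "m_hat p \<beta> \<delta> = min 1 (sqrt \<beta>) * (2 * sqrt (real p)) * arcsin (\<delta> / (2 * sqrt (real p)))"

definition M_hat :: "real \<Rightarrow> real \<Rightarrow> real" where
  "M_hat \<beta> \<delta> = max 1 (sqrt \<beta>) * (if \<delta> \<le> 2 then 2 * arcsin (\<delta> / 2) else pi / 2 * \<delta>)"

end

theory Submission
  imports Defs
begin

text \<open>
  The \<open>\<beta>\<close>-norm lies between \<open>min 1 (sqrt \<beta>)\<close> and \<open>max 1 (sqrt \<beta>)\<close> times the Frobenius norm, so it
  suffices to bound Frobenius lengths. The lower bound is the length of great circle arcs, since
  the Stiefel manifold lies on the sphere of radius \<open>sqrt p\<close>.

  For the upper bound \<open>\<pi>/2 * norm (V - U)\<close>, suppose first that \<open>U + V\<close> is injective. Then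
  \<open>V - U = A (U + V)\<close> with \<open>A\<close> skew, i.e. \<open>V\<close> is the image of \<open>U\<close> under a Cayley transform; rotating in
  the eigenspaces of \<open>A\<^sup>2\<close> at constant speed joins \<open>U\<close> to \<open>V\<close>, and Jordan's inequality compares the
  arcs with their chords. As \<open>n \<ge> 2 p\<close>, the general case follows by a small perturbation of \<open>U\<close> in
  a direction orthogonal to the columns of \<open>U\<close> and \<open>V\<close>.

  For \<open>norm (V - U) = 2 sin (\<theta> / 2) < 2\<close>, following the gradient of \<open>W \<mapsto> W \<bullet> V\<close> decreases \<open>\<theta>\<close> at least
  at unit rate. Instead of solving the gradient flow one minimises \<open>\<theta>\<close> plus slightly less than the
  distance from \<open>U\<close> over a compact set; the minimiser must be \<open>V\<close>.
\<close>

section \<open>Curves generated by skew matrices\<close>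

text \<open>Induction on the dimension: a maximiser of the quadratic form of \<open>T\<close> on the
  unit sphere of \<open>S\<close> is an eigenvector, and since \<open>T\<close> is selfadjoint, the
  orthogonal complement of that vector in \<open>S\<close> is again invariant. The invariant
  subspace is a parameter so that the induction applies to this complement.\<close>

lemma selfadjoint_eigenbasis_subspace:
  fixes T :: "'a::euclidean_space \<Rightarrow> 'a"
  assumes T: "linear T" and sa: "\<And>x y. T x \<bullet> y = x \<bullet> T y"
    and "subspace S" "T ` S \<subseteq> S"
  shows "\<exists>B \<mu>. finite B \<and> B \<subseteq> S \<and> span B = S \<and> pairwise orthogonal B
    \<and> (\<forall>b\<in>B. norm b = 1 \<and> T b = \<mu> b *\<^sub>R b)"
  using assms(3,4)
proof (induction "dim S" arbitrary: S rule: less_induct)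
  case less
  show ?case
  proof (cases "S = {0}")
    case True
    then show ?thesis by (intro exI[of _ "{}"]) auto
  next
    case False
    interpret T: linear T by (rule T)
    let ?K = "S \<inter> sphere 0 1"
    obtain x where x: "x \<in> S" "x \<noteq> 0"
      using False subspace_0[OF less.prems(1)] by blast
    have "x /\<^sub>R norm x \<in> ?K"
      using x subspace_scale[OF less.prems(1)] by auto
    moreover have "compact ?K"
      using closed_subspace[OF less.prems(1)] by (intro closed_Int_compact) auto
    moreover have "continuous_on ?K (\<lambda>x. x \<bullet> T x)"
      by (intro continuous_intros linear_continuous_on linear_conv_bounded_linear[THEN iffD1] T)
    ultimately obtain b where b: "b \<in> ?K" and max: "\<And>x. x \<in> ?K \<Longrightarrow> x \<bullet> T x \<le> b \<bullet> T b"
      using continuous_attains_sup[of ?K "\<lambda>x. x \<bullet> T x"] by blast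
    have bS: "b \<in> S" and b1: "norm b = 1" and bb: "b \<bullet> b = 1"
      using b by (auto simp: norm_eq_1)
    define l where "l = b \<bullet> T b"
    have le: "y \<bullet> T y \<le> l * (y \<bullet> y)" if "y \<in> S" for y
    proof (cases "y = 0")
      case False
      have "(y /\<^sub>R norm y) \<bullet> T (y /\<^sub>R norm y) \<le> l"
        unfolding l_def using that False subspace_scale[OF less.prems(1)] by (intro max) auto
      then have "(y \<bullet> T y) / (norm y)\<^sup>2 \<le> l"
        by (simp add: T.scaleR power2_eq_square divide_inverse mult_ac)
      then show ?thesis
        using False by (simp add: power2_norm_eq_inner pos_divide_le_eq)
    qed simp
    \<comment> \<open>First-order condition at the maximiser \<open>b\<close>: inserting b + t y
      into \<open>le\<close> gives a quadratic in t that vanishes at 0 and is nowhere positive, so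
      its linear coefficient must vanish.\<close>
    have orth: "y \<bullet> T b = 0" if y: "y \<in> S" "y \<bullet> b = 0" for y
    proof -
      let ?c = "y \<bullet> T b" and ?d = "y \<bullet> T y - l * (y \<bullet> y)"
      have ineq: "2 * t * ?c + t\<^sup>2 * ?d \<le> 0" for t :: real
      proof -
        have "b + t *\<^sub>R y \<in> S"
          using bS y less.prems(1) by (simp add: subspace_add subspace_scale)
        from le[OF this] show ?thesis
          using bb y(2) sa[of b y]
          by (simp add: T.add T.scaleR inner_simps l_def[symmetric] power2_eq_square algebra_simps
              inner_commute)
      qed
      show ?thesis
      proof (rule ccontr)
        assume "?c \<noteq> 0"
        \<comment> \<open>With t = e c the quadratic becomes e c^2 (2 + e d), and this choice of
          \<open>e\<close> keeps e |d| below 1, so the value would be positive.\<close>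
        define e where "e = 1 / (\<bar>?d\<bar> + 1)"
        have e: "e > 0" "e * \<bar>?d\<bar> < 1"
          by (auto simp: e_def divide_simps)
        have "2 * (e * ?c) * ?c + (e * ?c)\<^sup>2 * ?d \<le> 0" by (rule ineq)
        then have "(e * ?c\<^sup>2) * (2 + e * ?d) \<le> 0"
          by (simp add: power2_eq_square algebra_simps)
        moreover have "e * ?c\<^sup>2 > 0" using e \<open>?c \<noteq> 0\<close> by simp
        moreover have "2 + e * ?d > 0"
        proof -
          have "- (e * \<bar>?d\<bar>) \<le> e * ?d" using e(1) by (metis abs_ge_minus_self abs_mult abs_of_pos minus_le_iff)
          then show ?thesis using e(2) by linarith
        qed
        ultimately show False by (metis mult_pos_pos not_le)
      qed
    qed
    \<comment> \<open>The residual \<open>?z\<close> is orthogonal to \<open>b\<close> by the choice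
      of \<open>l\<close> and to \<open>T b\<close> by \<open>orth\<close>, hence to itself.\<close>
    have Tb: "T b = l *\<^sub>R b"
    proof -
      let ?z = "T b - l *\<^sub>R b"
      have "?z \<in> S" using less.prems bS by (auto intro!: subspace_diff subspace_scale)
      moreover have zb: "?z \<bullet> b = 0"
        using bb by (simp add: inner_simps l_def inner_commute)
      ultimately have "?z \<bullet> T b = 0" by (rule orth)
      with zb have "?z \<bullet> ?z = 0" by (simp add: inner_simps)
      then show ?thesis by simp
    qed
    define S' where "S' = {y \<in> S. y \<bullet> b = 0}"
    have S': "subspace S'"
      using less.prems(1) unfolding S'_def subspace_def by (auto simp: inner_simps)
    have inv: "T ` S' \<subseteq> S'"
      using less.prems(2) by (auto simp: S'_def sa Tb)
    have "b \<notin> S'" using bb by (simp add: S'_def)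
    then have "S' \<subset> S" using bS unfolding S'_def by blast
    then have "dim S' < dim S"
      using S' less.prems(1) by (metis dim_psubset span_eq_iff)
    from less.hyps[OF this S' inv] obtain B \<mu> where B: "finite B" "B \<subseteq> S'" "span B = S'"
      "pairwise orthogonal B" "\<forall>b\<in>B. norm b = 1 \<and> T b = \<mu> b *\<^sub>R b" by blast
    have "b \<notin> B" using B(2) \<open>b \<notin> S'\<close> by blast
    have "S \<subseteq> span (insert b B)"
    proof
      fix y assume y: "y \<in> S"
      have "y - (y \<bullet> b) *\<^sub>R b \<in> span B"
        unfolding B(3) S'_def using y bS bb less.prems(1)
        by (auto intro!: subspace_diff subspace_scale simp: inner_simps)
      then show "y \<in> span (insert b B)"
        by (auto simp: span_insert)
    qed
    moreover have "insert b B \<subseteq> S" using bS B(2) by (auto simp: S'_def)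
    ultimately have "span (insert b B) = S"
      using less.prems(1) by (metis span_minimal subset_antisym)
    moreover have "pairwise orthogonal (insert b B)"
      using B(2,4) by (auto simp: pairwise_insert orthogonal_def S'_def inner_commute)
    ultimately show ?thesis
      using B b1 Tb \<open>b \<notin> B\<close> \<open>insert b B \<subseteq> S\<close>
      by (intro exI[of _ "insert b B"] exI[of _ "\<mu>(b := l)"]) auto
  qed
qed

lemma skew_inner:
  fixes A :: "real^'n^'n"
  assumes "transpose A = - A"
  shows "(A *v x) \<bullet> y = - (x \<bullet> (A *v y))"
proof -
  have "(A *v x) \<bullet> y = x \<bullet> (transpose A *v y)"
    by (metis dot_lmul_matrix inner_commute transpose_matrix_vector transpose_transpose)
  also have "transpose A *v y = - (A *v y)"
    unfolding assms by (simp add: matrix_vector_mult_def vec_eq_iff sum_negf)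
  finally show ?thesis by simp
qed

lemma norm_matrix_columns:
  fixes X :: "real^'p^'n"
  shows "(norm X)\<^sup>2 = (\<Sum>i\<in>UNIV. column i X \<bullet> column i X)"
  unfolding power2_norm_eq_inner inner_vec_def column_def by (simp, rule sum.swap)

lemma column_matrix_mult:
  fixes A :: "real^'n^'m" and X :: "real^'p^'n"
  shows "column i (A ** X) = A *v column i X"
  by (simp add: vec_eq_iff column_def matrix_matrix_mult_def matrix_vector_mult_def)

lemma matrix_eq_columns:
  fixes X Y :: "'a^'p^'n"
  shows "X = Y \<longleftrightarrow> (\<forall>i. column i X = column i Y)"
  by (auto simp: vec_eq_iff column_def)

lemma stiefel_columns:
  "U \<in> stiefel \<longleftrightarrow> (\<forall>i j. column i U \<bullet> column j U = (if i = j then 1 else 0))"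
  by (auto simp: stiefel_def matrix_mult_transpose_dot_column vec_eq_iff mat_def)

section \<open>Functional calculus of a skew matrix\<close>

text \<open>A real skew matrix need not have real eigenvectors, but its square is symmetric and
  negative semidefinite. An orthonormal eigenbasis of the square, with eigenvalues - \<mu>,
  therefore replaces the complex diagonalisation of \<open>A\<close>.\<close>

locale skew_eigenbasis =
  fixes A :: "real^'n^'n" and B :: "(real^'n) set" and \<mu> :: "real^'n \<Rightarrow> real"
  assumes skew: "transpose A = - A"
    and finite: "finite B" and span: "span B = UNIV" and orth: "pairwise orthogonal B"
    and norm1: "b \<in> B \<Longrightarrow> norm b = 1"
    and eigen: "b \<in> B \<Longrightarrow> A *v (A *v b) = - (\<mu> b *\<^sub>R b)"
begin

lemma inner_basis: "b \<in> B \<Longrightarrow> b' \<in> B \<Longrightarrow> b \<bullet> b' = (if b = b' then 1 else 0)"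
  using orth norm1 by (auto simp: pairwise_def orthogonal_def norm_eq_1)

lemma expansion: "x = (\<Sum>b\<in>B. (x \<bullet> b) *\<^sub>R b)"
proof -
  let ?z = "x - (\<Sum>b\<in>B. (x \<bullet> b) *\<^sub>R b)"
  have "orthogonal ?z b" if "b \<in> B" for b
    using that finite
    by (simp add: orthogonal_def inner_diff_left inner_sum_left inner_basis if_distrib sum.delta'
        cong: if_cong)
  then have "orthogonal ?z ?z"
    by (rule orthogonal_to_span[of ?z B ?z, unfolded span, OF UNIV_I])
  then show ?thesis by (simp add: orthogonal_def)
qed

lemma inner_skew_basis:
  assumes "b \<in> B" "b' \<in> B"
  shows "(A *v b) \<bullet> (A *v b') = (if b = b' then \<mu> b else 0)"
  using assms by (simp add: skew_inner[OF skew] eigen inner_basis)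

lemma mu_nonneg: "b \<in> B \<Longrightarrow> \<mu> b \<ge> 0"
  using inner_skew_basis[of b b] inner_ge_zero[of "A *v b"] by simp

lemma skew_basis_eq_0: "b \<in> B \<Longrightarrow> \<mu> b = 0 \<Longrightarrow> A *v b = 0"
  using inner_skew_basis[of b b] by simp

text \<open>\<open>A\<close> commutes with its square, so \<open>A *v b'\<close> is in the same
  eigenspace of the square as \<open>b'\<close>; eigenspaces for different eigenvalues are
  orthogonal.\<close>

lemma inner_basis_skew:
  assumes b: "b \<in> B" "b' \<in> B" and ne: "\<mu> b \<noteq> \<mu> b'"
  shows "b \<bullet> (A *v b') = 0"
proof -
  have "\<mu> b * (b \<bullet> (A *v b')) = - ((A *v (A *v b)) \<bullet> (A *v b'))"
    by (simp add: eigen b)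
  also have "\<dots> = - (b \<bullet> (A *v (A *v (A *v b'))))"
    by (simp add: skew_inner[OF skew])
  also have "A *v (A *v (A *v b')) = - (\<mu> b' *\<^sub>R (A *v b'))"
    by (simp add: eigen b matrix_vector_mult_scaleR linear_neg[OF matrix_vector_mul_linear])
  finally have "(\<mu> b - \<mu> b') * (b \<bullet> (A *v b')) = 0" by (simp add: algebra_simps)
  then show ?thesis using ne by simp
qed

text \<open>For a unit vector \<open>b\<close> this projects every column of \<open>Y\<close>
  orthogonally onto the line of \<open>b\<close>.\<close>

definition component :: "real^'n \<Rightarrow> real^'p^'n \<Rightarrow> real^'p^'n" where
  "component b Y = (\<chi> r i. (column i Y \<bullet> b) * b $ r)"

text \<open>When the weights depend only on \<open>\<mu> b\<close>, this is f(A) applied to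
  \<open>Y\<close>: \<open>p\<close> is the even part of f and \<open>q\<close> the odd part divided
  by its argument, both read as functions of A^2. For example, exp (t A) has the weights cos (t
  \<tau>) and sin (t \<tau>) / \<tau> with \<tau> = sqrt \<mu>.\<close>

definition rot :: "(real^'n \<Rightarrow> real) \<Rightarrow> (real^'n \<Rightarrow> real) \<Rightarrow> real^'p^'n \<Rightarrow> real^'p^'n" where
  "rot p q Y = (\<Sum>b\<in>B. p b *\<^sub>R component b Y + q b *\<^sub>R (A ** component b Y))"

lemma column_rot:
  fixes Y :: "real^'q^'n"
  shows "column i (rot p q Y) = (\<Sum>b\<in>B. (column i Y \<bullet> b) *\<^sub>R (p b *\<^sub>R b + q b *\<^sub>R (A *v b)))"
proof -
  have sum: "column i (\<Sum>b\<in>B. F b) = (\<Sum>b\<in>B. column i (F b))" for F :: "real^'n \<Rightarrow> real^'q^'n"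
    by (simp add: vec_eq_iff column_def)
  have "column i (component b Y) = (column i Y \<bullet> b) *\<^sub>R b" for b
    by (simp add: component_def vec_eq_iff column_def)
  moreover have "column i (X + Z) = column i X + column i Z" "column i (r *\<^sub>R X) = r *\<^sub>R column i X"
    for X Z :: "real^'q^'n" and r
    by (simp_all add: vec_eq_iff column_def)
  ultimately show ?thesis
    unfolding rot_def sum
    by (simp add: column_matrix_mult matrix_vector_mult_scaleR algebra_simps)
qed

lemma rot_id: "rot (\<lambda>b. 1) (\<lambda>b. 0) Y = Y"
  unfolding matrix_eq_columns by (simp add: column_rot expansion[symmetric])

lemma rot_skew: "rot (\<lambda>b. 0) (\<lambda>b. 1) Y = A ** Y"
proof -
  have "column i (rot (\<lambda>b. 0) (\<lambda>b. 1) Y) = A *v column i Y" for i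
    unfolding column_rot
    by (subst (3) expansion) (simp add: linear_sum[OF matrix_vector_mul_linear] matrix_vector_mult_scaleR)
  then show ?thesis by (simp add: matrix_eq_columns column_matrix_mult)
qed

lemma rot_combination: "rot (\<lambda>b. r) (\<lambda>b. s) Y = r *\<^sub>R Y + s *\<^sub>R (A ** Y)"
proof -
  have "rot (\<lambda>b. r) (\<lambda>b. s) Y = r *\<^sub>R rot (\<lambda>b. 1) (\<lambda>b. 0) Y + s *\<^sub>R rot (\<lambda>b. 0) (\<lambda>b. 1) Y"
    by (simp add: rot_def scaleR_sum_right sum.distrib)
  then show ?thesis by (simp add: rot_id rot_skew)
qed

text \<open>Where \<open>\<mu> b = 0\<close>, \<open>A\<close> annihilates \<open>b\<close>, so the
  value of \<open>q b\<close> does not matter. This absorbs quotients by sqrt \<mu> at the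
  eigenvalue 0.\<close>

lemma rot_cong:
  assumes "\<And>b. b \<in> B \<Longrightarrow> p b = p' b" "\<And>b. b \<in> B \<Longrightarrow> \<mu> b \<noteq> 0 \<Longrightarrow> q b = q' b"
  shows "rot p q Y = rot p' q' Y"
proof -
  have "p b *\<^sub>R b + q b *\<^sub>R (A *v b) = p' b *\<^sub>R b + q' b *\<^sub>R (A *v b)" if "b \<in> B" for b
    using that assms skew_basis_eq_0[of b] by (cases "\<mu> b = 0") auto
  then show ?thesis by (simp add: matrix_eq_columns column_rot)
qed

text \<open>The cross terms between \<open>b\<close> and \<open>A *v b'\<close> cancel: for equal
  eigenvalues because the weights agree, for different ones by \<open>inner_basis_skew\<close>. The
  Gram matrix of the columns then depends on the weights only through p^2 + \<mu> q^2, so a curve of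
  weights keeping this quantity fixed preserves orthonormal columns.\<close>

lemma inner_rot:
  assumes pq: "\<And>b b'. b \<in> B \<Longrightarrow> b' \<in> B \<Longrightarrow> \<mu> b = \<mu> b' \<Longrightarrow> p b = p b' \<and> q b = q b'"
  shows "column i (rot p q Y) \<bullet> column j (rot p q Y)
    = (\<Sum>b\<in>B. ((p b)\<^sup>2 + \<mu> b * (q b)\<^sup>2) * ((column i Y \<bullet> b) * (column j Y \<bullet> b)))"
proof -
  let ?v = "\<lambda>b. p b *\<^sub>R b + q b *\<^sub>R (A *v b)"
  have v: "?v b \<bullet> ?v b' = (if b = b' then (p b)\<^sup>2 + \<mu> b * (q b)\<^sup>2 else 0)"
    if b: "b \<in> B" "b' \<in> B" for b b'
  proof -
    have "?v b \<bullet> ?v b' = p b * p b' * (b \<bullet> b') + (p b * q b' - q b * p b') * (b \<bullet> (A *v b'))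
        + q b * q b' * ((A *v b) \<bullet> (A *v b'))"
      using skew_inner[OF skew, of b b'] by (simp add: inner_simps algebra_simps)
    moreover have "(p b * q b' - q b * p b') * (b \<bullet> (A *v b')) = 0"
      using pq[OF b] inner_basis_skew[OF b] by (cases "\<mu> b = \<mu> b'") auto
    ultimately show ?thesis
      using b by (simp add: inner_basis inner_skew_basis power2_eq_square)
  qed
  show ?thesis
    unfolding column_rot inner_sum_left inner_sum_right inner_scaleR_left inner_scaleR_right
    using finite by (simp add: v if_distrib sum.delta' cong: if_cong) (simp add: algebra_simps)
qed

lemma norm_rot:
  assumes "\<And>b b'. b \<in> B \<Longrightarrow> b' \<in> B \<Longrightarrow> \<mu> b = \<mu> b' \<Longrightarrow> p b = p b' \<and> q b = q b'"
  shows "(norm (rot p q Y))\<^sup>2 = (\<Sum>b\<in>B. ((p b)\<^sup>2 + \<mu> b * (q b)\<^sup>2) * (\<Sum>i\<in>UNIV. (column i Y \<bullet> b)\<^sup>2))"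
proof -
  have "(norm (rot p q Y))\<^sup>2
      = (\<Sum>i\<in>UNIV. \<Sum>b\<in>B. ((p b)\<^sup>2 + \<mu> b * (q b)\<^sup>2) * (column i Y \<bullet> b)\<^sup>2)"
    by (simp only: norm_matrix_columns inner_rot[OF assms] power2_eq_square[of "column i Y \<bullet> b" for i b])
  then show ?thesis
    by (subst (asm) sum.swap) (simp add: sum_distrib_left)
qed

lemma norm_skew_mult: "(norm (A ** Y))\<^sup>2 = (\<Sum>b\<in>B. \<mu> b * (\<Sum>i\<in>UNIV. (column i Y \<bullet> b)\<^sup>2))"
  using norm_rot[of "\<lambda>_. 0" "\<lambda>_. 1" Y] by (simp add: rot_skew)

lemma has_vector_derivative_rot:
  assumes "\<And>b. b \<in> B \<Longrightarrow> ((\<lambda>t. p t b) has_real_derivative p' b) (at t)"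
    and "\<And>b. b \<in> B \<Longrightarrow> ((\<lambda>t. q t b) has_real_derivative q' b) (at t)"
  shows "((\<lambda>t. rot (p t) (q t) Y) has_vector_derivative rot p' q' Y) (at t)"
  unfolding rot_def
  by (rule derivative_eq_intros assms refl | assumption | simp)+

lemma continuous_on_rot:
  assumes "\<And>b. b \<in> B \<Longrightarrow> continuous_on S (\<lambda>t. p t b)"
    and "\<And>b. b \<in> B \<Longrightarrow> continuous_on S (\<lambda>t. q t b)"
  shows "continuous_on S (\<lambda>t. rot (p t) (q t) Y)"
  unfolding rot_def by (intro continuous_intros assms)

end

lemma skew_eigenbasis_exists:
  fixes A :: "real^'n^'n"
  assumes "transpose A = - A"
  obtains B \<mu> where "skew_eigenbasis A B \<mu>"
proof -
  have "linear (\<lambda>x. A *v (A *v x))"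
    using linear_compose[OF matrix_vector_mul_linear[of A] matrix_vector_mul_linear[of A]]
    by (simp add: o_def)
  then obtain B \<mu> where "finite B" "span B = UNIV" "pairwise orthogonal B"
    "\<forall>b\<in>B. norm b = 1 \<and> A *v (A *v b) = \<mu> b *\<^sub>R b"
    using selfadjoint_eigenbasis_subspace[of "\<lambda>x. A *v (A *v x)" UNIV]
    by (auto simp: skew_inner[OF assms])
  then have "skew_eigenbasis A B (\<lambda>b. - \<mu> b)"
    using assms by unfold_locales auto
  then show ?thesis by (rule that)
qed

text \<open>The curve is \<open>exp (t A) W\<close>.\<close>

lemma skew_flow:
  fixes A :: "real^'n^'n" and W :: "real^'p^'n"
  assumes A: "transpose A = - A" and W: "W \<in> stiefel"
  obtains \<gamma> \<gamma>' where "\<And>t. (\<gamma> has_vector_derivative \<gamma>' t) (at t)" "continuous_on UNIV \<gamma>'"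
    "\<gamma> 0 = W" "\<gamma>' 0 = A ** W" "\<And>t. \<gamma> t \<in> stiefel" "\<And>t. norm (\<gamma>' t) = norm (A ** W)"
proof -
  obtain B \<mu> where "skew_eigenbasis A B \<mu>" by (rule skew_eigenbasis_exists[OF A])
  then interpret skew_eigenbasis A B \<mu> .
  define \<tau> where "\<tau> b = sqrt (\<mu> b)" for b
  \<comment> \<open>At \<open>\<tau> b = 0\<close> the convention for \<open>inverse\<close> makes
    this 0, so such \<open>b\<close> stay fixed; the identities that need \<sigma> \<tau> = 1 are
    proved by cases.\<close>
  define \<sigma> where "\<sigma> b = inverse (\<tau> b)" for b
  have \<tau>: "(\<tau> b)\<^sup>2 = \<mu> b" if "b \<in> B" for b
    using mu_nonneg[OF that] by (simp add: \<tau>_def)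
  define p where "p t b = cos (t * \<tau> b)" for t b
  define q where "q t b = \<sigma> b * sin (t * \<tau> b)" for t b
  define p' where "p' t b = - \<tau> b * sin (t * \<tau> b)" for t b
  define q' where "q' t b = \<sigma> b * \<tau> b * cos (t * \<tau> b)" for t b
  define \<gamma> where "\<gamma> t = rot (p t) (q t) W" for t
  define \<gamma>' where "\<gamma>' t = rot (p' t) (q' t) W" for t
  have dep: "\<tau> b = \<tau> b' \<and> \<sigma> b = \<sigma> b'" if "\<mu> b = \<mu> b'" for b b' using that by (simp add: \<tau>_def \<sigma>_def)
  show ?thesis
  proof
    show "(\<gamma> has_vector_derivative \<gamma>' t) (at t)" for t
      unfolding \<gamma>_def \<gamma>'_def p_def q_def p'_def q'_def
      by (rule has_vector_derivative_rot) (auto intro!: derivative_eq_intros)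
    show "continuous_on UNIV \<gamma>'"
      unfolding \<gamma>'_def[abs_def] p'_def q'_def
      by (rule continuous_on_rot; intro continuous_intros)
    have "\<gamma> 0 = rot (\<lambda>b. 1) (\<lambda>b. 0) W"
      unfolding \<gamma>_def by (rule rot_cong) (auto simp: p_def q_def)
    then show "\<gamma> 0 = W" by (simp add: rot_id)
    have "\<gamma>' 0 = rot (\<lambda>b. 0) (\<lambda>b. 1) W"
      unfolding \<gamma>'_def by (rule rot_cong) (auto simp: p'_def q'_def \<sigma>_def \<tau>_def)
    then show "\<gamma>' 0 = A ** W" by (simp add: rot_skew)
    show "\<gamma> t \<in> stiefel" for t
    proof -
      have "column i (\<gamma> t) \<bullet> column j (\<gamma> t) = column i W \<bullet> column j W" for i j
      proof -
        have "column i (\<gamma> t) \<bullet> column j (\<gamma> t)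
          = (\<Sum>b\<in>B. ((p t b)\<^sup>2 + \<mu> b * (q t b)\<^sup>2) * ((column i W \<bullet> b) * (column j W \<bullet> b)))"
          unfolding \<gamma>_def by (rule inner_rot) (metis dep p_def q_def)
        also have "\<dots> = (\<Sum>b\<in>B. ((1::real)\<^sup>2 + \<mu> b * 0\<^sup>2) * ((column i W \<bullet> b) * (column j W \<bullet> b)))"
        proof (rule sum.cong[OF refl])
          fix b assume b: "b \<in> B"
          have "(p t b)\<^sup>2 + \<mu> b * (q t b)\<^sup>2 = 1"
          proof (cases "\<tau> b = 0")
            case False
            then have "\<mu> b * (\<sigma> b)\<^sup>2 = 1"
              by (simp add: \<sigma>_def \<tau>[OF b, symmetric] power_inverse)
            then have "(p t b)\<^sup>2 + \<mu> b * (q t b)\<^sup>2 = (cos (t * \<tau> b))\<^sup>2 + (sin (t * \<tau> b))\<^sup>2"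
              unfolding p_def q_def by algebra
            then show ?thesis by simp
          qed (simp add: p_def q_def \<tau>[OF b, symmetric])
          then show "((p t b)\<^sup>2 + \<mu> b * (q t b)\<^sup>2) * ((column i W \<bullet> b) * (column j W \<bullet> b))
            = ((1::real)\<^sup>2 + \<mu> b * 0\<^sup>2) * ((column i W \<bullet> b) * (column j W \<bullet> b))" by simp
        qed
        also have "\<dots> = column i W \<bullet> column j W"
          using inner_rot[of "\<lambda>_. 1" "\<lambda>_. 0" i W j] by (simp add: rot_id)
        finally show ?thesis .
      qed
      then show ?thesis using W by (simp add: stiefel_columns)
    qed
    show "norm (\<gamma>' t) = norm (A ** W)" for t
    proof -
      have "(norm (\<gamma>' t))\<^sup>2
          = (\<Sum>b\<in>B. ((p' t b)\<^sup>2 + \<mu> b * (q' t b)\<^sup>2) * (\<Sum>i\<in>UNIV. (column i W \<bullet> b)\<^sup>2))"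
        unfolding \<gamma>'_def by (rule norm_rot) (metis dep p'_def q'_def)
      also have "\<dots> = (norm (A ** W))\<^sup>2"
        unfolding norm_skew_mult
      proof (rule sum.cong[OF refl])
        fix b assume b: "b \<in> B"
        have "(p' t b)\<^sup>2 + \<mu> b * (q' t b)\<^sup>2 = \<mu> b"
          by (cases "\<tau> b = 0")
             (simp_all add: p'_def q'_def \<sigma>_def \<tau>[OF b, symmetric] power_mult_distrib distrib_left[symmetric])
        then show "((p' t b)\<^sup>2 + \<mu> b * (q' t b)\<^sup>2) * (\<Sum>i\<in>UNIV. (column i W \<bullet> b)\<^sup>2)
          = \<mu> b * (\<Sum>i\<in>UNIV. (column i W \<bullet> b)\<^sup>2)" by simp
      qed
      finally show ?thesis by (simp add: power2_eq_iff_nonneg)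
    qed
  qed
qed

section \<open>Arcs of the Cayley transform\<close>

text \<open>For x = tan \<psi> this is Jordan's inequality \<psi> \<le> (pi / 2) sin \<psi>, which
  holds because the concave sine lies above its chord from 0 to pi / 2.\<close>

lemma arctan_le_chord:
  assumes "x \<ge> 0"
  shows "2 * arctan x * sqrt (1 + x\<^sup>2) \<le> pi * x"
proof -
  have c: "0 \<le> arctan x" "arctan x \<le> pi / 2" using assms arctan_ubound[of x] by auto
  have "2 / pi * arctan x \<le> sin (arctan x)"
  proof -
    have "concave_on {0..pi} sin"
      by (rule f''_le0_imp_concave[where f' = cos and f'' = "\<lambda>x. - sin x"])
         (auto intro!: derivative_eq_intros sin_ge_zero)
    then have "(1 - t) * sin 0 + t * sin (pi / 2) \<le> sin ((1 - t) *\<^sub>R 0 + t *\<^sub>R (pi / 2))"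
      if "0 \<le> t" "t \<le> 1" for t
      using that by (intro concave_onD) auto
    from this[of "2 / pi * arctan x"] show ?thesis
      using c by (simp add: field_simps)
  qed
  then have "2 * arctan x \<le> pi * x / sqrt (1 + x\<^sup>2)"
    by (simp add: sin_arctan field_simps)
  then show ?thesis
    by (subst (asm) pos_le_divide_eq) (simp_all add: add_pos_nonneg)
qed

text \<open>
  An eigenvalue \<open>\<mu> = \<tau>\<^sup>2\<close> of \<open>- A\<^sup>2\<close> corresponds to a rotation by \<open>\<phi> = 2 arctan \<tau>\<close> under the Cayley
  transform of \<open>A\<close>. Measuring time from the midpoint \<open>Y / 2\<close> of the chord makes the curve
  symmetric, with the constant radius \<open>c = 1 / (2 cos (\<phi> / 2))\<close>.
\<close>

lemma skew_chord:
  fixes A :: "real^'n^'n" and Y :: "real^'p^'n"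
  assumes A: "transpose A = - A" and U: "(1/2) *\<^sub>R (Y - A ** Y) \<in> stiefel"
  obtains \<gamma> \<gamma>' where "\<And>t. (\<gamma> has_vector_derivative \<gamma>' t) (at t)" "continuous_on UNIV \<gamma>'"
    "\<gamma> 0 = (1/2) *\<^sub>R (Y - A ** Y)" "\<gamma> 1 = (1/2) *\<^sub>R (Y + A ** Y)"
    "\<And>t. \<gamma> t \<in> stiefel" "\<And>t. norm (\<gamma>' t) \<le> pi / 2 * norm (A ** Y)"
proof -
  obtain B \<mu> where "skew_eigenbasis A B \<mu>" by (rule skew_eigenbasis_exists[OF A])
  then interpret skew_eigenbasis A B \<mu> .
  define \<tau> where "\<tau> b = sqrt (\<mu> b)" for b
  define \<sigma> where "\<sigma> b = inverse (\<tau> b)" for b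
  have \<tau>: "(\<tau> b)\<^sup>2 = \<mu> b" if "b \<in> B" for b
    using mu_nonneg[OF that] by (simp add: \<tau>_def)
  define \<phi> where "\<phi> b = 2 * arctan (\<tau> b)" for b
  define c where "c b = sqrt (1 + \<mu> b) / 2" for b
  have c2: "(c b)\<^sup>2 = (1 + \<mu> b) / 4" if "b \<in> B" for b
    using mu_nonneg[OF that] by (simp add: c_def power_divide)
  define p where "p t b = c b * cos ((t - 1/2) * \<phi> b)" for t b
  define q where "q t b = \<sigma> b * c b * sin ((t - 1/2) * \<phi> b)" for t b
  define p' where "p' t b = - c b * \<phi> b * sin ((t - 1/2) * \<phi> b)" for t b
  define q' where "q' t b = \<sigma> b * c b * \<phi> b * cos ((t - 1/2) * \<phi> b)" for t b
  define \<gamma> where "\<gamma> t = rot (p t) (q t) Y" for t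
  define \<gamma>' where "\<gamma>' t = rot (p' t) (q' t) Y" for t
  have dep: "\<tau> b = \<tau> b' \<and> \<sigma> b = \<sigma> b' \<and> c b = c b' \<and> \<phi> b = \<phi> b'" if "\<mu> b = \<mu> b'" for b b'
    using that by (simp add: \<tau>_def \<sigma>_def c_def \<phi>_def)
  \<comment> \<open>The radius \<open>c\<close> is chosen so that at the times 0 and 1 the weight
    \<open>p\<close> is 1/2 and the weight \<open>q\<close> is -1/2 and 1/2, as the prescribed
    endpoints demand.\<close>
  have ends: "c b * cos (\<phi> b / 2) = 1/2" "c b * sin (\<phi> b / 2) = \<tau> b / 2" if "b \<in> B" for b
    using mu_nonneg[OF that]
    by (simp_all add: c_def \<phi>_def cos_arctan sin_arctan \<tau>[OF that] add_nonneg_eq_0_iff)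
  have start: "\<gamma> 0 = (1/2) *\<^sub>R (Y - A ** Y)"
  proof -
    have "\<gamma> 0 = rot (\<lambda>b. 1/2) (\<lambda>b. - 1/2) Y"
      unfolding \<gamma>_def by (rule rot_cong) (auto simp: p_def q_def ends mult.assoc \<sigma>_def \<tau>_def)
    then show ?thesis unfolding rot_combination by (simp add: algebra_simps)
  qed
  \<comment> \<open>The Gram matrix does not depend on \<open>t\<close>, so membership in
    \<open>stiefel\<close> carries over from the time 0 to all times.\<close>
  have const: "column i (\<gamma> t) \<bullet> column j (\<gamma> t)
      = (\<Sum>b\<in>B. (1 + \<mu> b) / 4 * ((column i Y \<bullet> b) * (column j Y \<bullet> b)))" for i j t
  proof -
    have "column i (\<gamma> t) \<bullet> column j (\<gamma> t)
      = (\<Sum>b\<in>B. ((p t b)\<^sup>2 + \<mu> b * (q t b)\<^sup>2) * ((column i Y \<bullet> b) * (column j Y \<bullet> b)))"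
      unfolding \<gamma>_def by (rule inner_rot) (metis dep p_def q_def)
    also have "\<dots> = (\<Sum>b\<in>B. (1 + \<mu> b) / 4 * ((column i Y \<bullet> b) * (column j Y \<bullet> b)))"
    proof (rule sum.cong[OF refl])
      fix b assume b: "b \<in> B"
      have "(p t b)\<^sup>2 + \<mu> b * (q t b)\<^sup>2 = (c b)\<^sup>2"
      proof (cases "\<tau> b = 0")
        case False
        then have "\<mu> b * (\<sigma> b)\<^sup>2 = 1"
          by (simp add: \<sigma>_def \<tau>[OF b, symmetric] power_inverse)
        then have "(p t b)\<^sup>2 + \<mu> b * (q t b)\<^sup>2
          = (c b)\<^sup>2 * ((cos ((t - 1/2) * \<phi> b))\<^sup>2 + (sin ((t - 1/2) * \<phi> b))\<^sup>2)"
          unfolding p_def q_def by algebra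
        then show ?thesis by simp
      qed (simp add: p_def q_def \<phi>_def \<sigma>_def \<tau>[OF b, symmetric])
      then show "((p t b)\<^sup>2 + \<mu> b * (q t b)\<^sup>2) * ((column i Y \<bullet> b) * (column j Y \<bullet> b))
        = (1 + \<mu> b) / 4 * ((column i Y \<bullet> b) * (column j Y \<bullet> b))" by (simp add: c2[OF b])
    qed
    finally show ?thesis .
  qed
  have trig:
    "((\<lambda>t. k * cos ((t - 1/2) * r)) has_real_derivative - k * r * sin ((t - 1/2) * r)) (at t)"
    "((\<lambda>t. k * sin ((t - 1/2) * r)) has_real_derivative k * r * cos ((t - 1/2) * r)) (at t)"
    for k r t :: real
    by (auto intro!: derivative_eq_intros)
  show ?thesis
  proof
    show "(\<gamma> has_vector_derivative \<gamma>' t) (at t)" for t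
      unfolding \<gamma>_def \<gamma>'_def p_def q_def p'_def q'_def
      by (rule has_vector_derivative_rot) (rule trig)+
    show "continuous_on UNIV \<gamma>'"
      unfolding \<gamma>'_def[abs_def] p'_def q'_def
      by (rule continuous_on_rot; intro continuous_intros)
    show "\<gamma> 0 = (1/2) *\<^sub>R (Y - A ** Y)" by (rule start)
    have "\<gamma> 1 = rot (\<lambda>b. 1/2) (\<lambda>b. 1/2) Y"
      unfolding \<gamma>_def by (rule rot_cong) (auto simp: p_def q_def ends mult.assoc \<sigma>_def \<tau>_def)
    then show "\<gamma> 1 = (1/2) *\<^sub>R (Y + A ** Y)"
      unfolding rot_combination by (simp add: algebra_simps)
    show "\<gamma> t \<in> stiefel" for t
      using U[folded start] unfolding stiefel_columns const .
    show "norm (\<gamma>' t) \<le> pi / 2 * norm (A ** Y)" for t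
    proof (rule power2_le_imp_le)
      have "(norm (\<gamma>' t))\<^sup>2
          = (\<Sum>b\<in>B. ((p' t b)\<^sup>2 + \<mu> b * (q' t b)\<^sup>2) * (\<Sum>i\<in>UNIV. (column i Y \<bullet> b)\<^sup>2))"
        unfolding \<gamma>'_def by (rule norm_rot) (metis dep p'_def q'_def)
      also have "\<dots> \<le> (\<Sum>b\<in>B. ((pi/2)\<^sup>2 * \<mu> b) * (\<Sum>i\<in>UNIV. (column i Y \<bullet> b)\<^sup>2))"
      proof (intro sum_mono mult_right_mono sum_nonneg)
        fix b assume b: "b \<in> B"
        \<comment> \<open>On the line of \<open>b\<close> the speed is angle times radius, the chord
          \<open>A ** Y\<close> contributes \<tau>, and \<open>arctan_le_chord\<close> compares the
          two.\<close>
        have "\<phi> b * c b \<le> pi / 2 * \<tau> b"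
          using arctan_le_chord[of "\<tau> b"] mu_nonneg[OF b] \<tau>[OF b] by (simp add: \<phi>_def c_def \<tau>_def)
        moreover have "0 \<le> \<phi> b * c b"
          using mu_nonneg[OF b] by (simp add: \<phi>_def c_def \<tau>_def)
        ultimately have le: "(\<phi> b * c b)\<^sup>2 \<le> (pi / 2 * \<tau> b)\<^sup>2" by (rule power_mono)
        have "(p' t b)\<^sup>2 + \<mu> b * (q' t b)\<^sup>2 = (\<phi> b * c b)\<^sup>2"
        proof (cases "\<tau> b = 0")
          case False
          then have "\<mu> b * (\<sigma> b)\<^sup>2 = 1"
            by (simp add: \<sigma>_def \<tau>[OF b, symmetric] power_inverse)
          then have "(p' t b)\<^sup>2 + \<mu> b * (q' t b)\<^sup>2
            = (\<phi> b * c b)\<^sup>2 * ((sin ((t - 1/2) * \<phi> b))\<^sup>2 + (cos ((t - 1/2) * \<phi> b))\<^sup>2)"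
            unfolding p'_def q'_def by algebra
          then show ?thesis by simp
        qed (simp add: p'_def q'_def \<phi>_def)
        then show "(p' t b)\<^sup>2 + \<mu> b * (q' t b)\<^sup>2 \<le> (pi/2)\<^sup>2 * \<mu> b"
          using le by (simp add: power_mult_distrib power_divide \<tau>[OF b])
      qed simp
      also have "\<dots> = (pi / 2 * norm (A ** Y))\<^sup>2"
        unfolding power_mult_distrib norm_skew_mult by (simp add: sum_distrib_left mult.assoc)
      finally show "(norm (\<gamma>' t))\<^sup>2 \<le> (pi / 2 * norm (A ** Y))\<^sup>2" .
    qed simp
  qed
qed

lemma matrix_mult_linear:
  fixes A B :: "real^'n^'m" and C D :: "real^'p^'n"
  shows "(A + B) ** C = A ** C + B ** C" "(A - B) ** C = A ** C - B ** C"
    "A ** (C + D) = A ** C + A ** D" "A ** (C - D) = A ** C - A ** D"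
    "(- A) ** C = - (A ** C)" "A ** (- C) = - (A ** C)"
    "(r *\<^sub>R A) ** C = r *\<^sub>R (A ** C)" "A ** (r *\<^sub>R C) = r *\<^sub>R (A ** C)"
  by (simp_all add: matrix_matrix_mult_def vec_eq_iff sum.distrib sum_subtractf sum_negf
      sum_distrib_left algebra_simps)

lemma transpose_linear:
  fixes A B :: "real^'n^'m"
  shows "transpose (A + B) = transpose A + transpose B" "transpose (A - B) = transpose A - transpose B"
    "transpose (- A) = - transpose A" "transpose (r *\<^sub>R A) = r *\<^sub>R transpose A"
  by (simp_all add: transpose_def vec_eq_iff)

text \<open>The condition on \<open>Z\<close> is forced, since \<open>transpose Y ** A ** Y\<close>
  is skew for every skew \<open>A\<close>; with a left inverse of \<open>Y\<close> it also
  suffices.\<close>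

lemma skew_interpolation:
  fixes Y Z :: "real^'p^'n" and P :: "real^'n^'p"
  assumes P: "P ** Y = mat 1" and skew: "transpose Z ** Y = - (transpose Y ** Z)"
  obtains A :: "real^'n^'n" where "transpose A = - A" "A ** Y = Z"
proof
  \<comment> \<open>\<open>Z ** P\<close> already maps \<open>Y\<close> to \<open>Z\<close>.
    Subtracting its transpose makes it skew but spoils the value at \<open>Y\<close>; the third term
    is itself skew and cancels that error.\<close>
  let ?A = "Z ** P - transpose P ** transpose Z - transpose P ** (transpose Y ** Z) ** P"
  show "transpose ?A = - ?A"
    by (simp add: transpose_linear matrix_transpose_mul skew matrix_mult_linear matrix_mul_assoc)
  show "?A ** Y = Z"
    by (simp add: matrix_mult_linear)
       (simp add: matrix_mul_assoc[symmetric] P skew matrix_mult_linear)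
qed

section \<open>Joining points by curves of bounded Frobenius length\<close>

text \<open>The length is bounded by \<open>l\<close> rather than equal to it, so that the relation
  is monotone in \<open>l\<close> and bounds add under concatenation. The derivative is an explicit
  witness, which keeps \<open>velocity\<close> out of the constructions.\<close>

definition joinable :: "real^'p^'n \<Rightarrow> real^'p^'n \<Rightarrow> real \<Rightarrow> bool" where
  "joinable U V l \<longleftrightarrow> (\<exists>\<gamma> \<gamma>'.
     (\<forall>t\<in>{0..1}. (\<gamma> has_vector_derivative \<gamma>' t) (at t within {0..1}) \<and> \<gamma> t \<in> stiefel)
     \<and> continuous_on {0..1} \<gamma>' \<and> \<gamma> 0 = U \<and> \<gamma> 1 = V \<and> integral {0..1} (\<lambda>t. norm (\<gamma>' t)) \<le> l)"

lemma joinable_mono: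
  assumes "joinable U V l" and le: "l \<le> m"
  shows "joinable U V m"
proof -
  obtain \<gamma> \<gamma>' where
    *: "\<forall>t\<in>{0..1}. (\<gamma> has_vector_derivative \<gamma>' t) (at t within {0..1}) \<and> \<gamma> t \<in> stiefel"
    "continuous_on {0..1} \<gamma>'" "\<gamma> 0 = U" "\<gamma> 1 = V"
    and "integral {0..1} (\<lambda>t. norm (\<gamma>' t)) \<le> l"
    using assms(1) unfolding joinable_def by blast
  then have "integral {0..1} (\<lambda>t. norm (\<gamma>' t)) \<le> m" using le by linarith
  with * show ?thesis unfolding joinable_def by blast
qed

lemma joinable_nonneg:
  fixes U V :: "real^'a^'b"
  shows "joinable U V l \<Longrightarrow> l \<ge> 0"
proof -
  assume "joinable U V l"
  then obtain \<gamma>' :: "real \<Rightarrow> real^'a^'b" where "continuous_on {0..1} \<gamma>'"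
    and le: "integral {0..1} (\<lambda>t. norm (\<gamma>' t)) \<le> l"
    unfolding joinable_def by blast
  then have "0 \<le> integral {0..1} (\<lambda>t. norm (\<gamma>' t))"
    by (intro integral_nonneg integrable_continuous_interval continuous_on_norm) simp_all
  with le show ?thesis by linarith
qed

lemma joinable_flow:
  assumes der: "\<And>t. (\<gamma> has_vector_derivative \<gamma>' t) (at t)" and cont: "continuous_on UNIV \<gamma>'"
    and st: "\<And>t. \<gamma> t \<in> stiefel" and bd: "\<And>t. norm (\<gamma>' t) \<le> k" and s: "s \<ge> 0"
  shows "joinable (\<gamma> 0) (\<gamma> s) (s * k)"
  unfolding joinable_def
proof (intro exI conjI ballI)
  have "((\<gamma> \<circ> (\<lambda>t. s * t)) has_vector_derivative s *\<^sub>R \<gamma>' (s * t)) (at t within {0..1})" for t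
    by (rule vector_diff_chain_within)
       (auto intro!: derivative_eq_intros has_vector_derivative_at_within der
         simp flip: has_real_derivative_iff_has_vector_derivative)
  then show "((\<lambda>t. \<gamma> (s * t)) has_vector_derivative s *\<^sub>R \<gamma>' (s * t)) (at t within {0..1})" for t
    by (simp add: o_def)
  show c: "continuous_on {0..1} (\<lambda>t. s *\<^sub>R \<gamma>' (s * t))"
    by (intro continuous_intros continuous_on_compose2[OF cont]) auto
  have "integral {0..1} (\<lambda>t. norm (s *\<^sub>R \<gamma>' (s * t))) \<le> integral {0..1} (\<lambda>t::real. s * k)"
    using s bd by (intro integral_le integrable_continuous_interval continuous_on_norm c)
      (auto intro!: mult_left_mono)
  then show "integral {0..1} (\<lambda>t. norm (s *\<^sub>R \<gamma>' (s * t))) \<le> s * k" by simp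
qed (auto simp: st)

text \<open>The squared positive part is continuously differentiable across 0; it supplies time
  changes that come to rest smoothly.\<close>

lemma has_real_derivative_max_0_square:
  "((\<lambda>x::real. (max 0 x)\<^sup>2) has_real_derivative 2 * max 0 x) (at x)"
proof -
  consider "x > 0" | "x < 0" | "x = 0" by linarith
  then show ?thesis
  proof cases
    case 1
    then have "eventually (\<lambda>y. y > 0) (nhds x)" using eventually_nhds_in_open[of "{0<..}" x] by simp
    then have ev: "eventually (\<lambda>y. (max 0 y)\<^sup>2 = y\<^sup>2) (nhds x)" by eventually_elim simp
    have "((\<lambda>y. y\<^sup>2) has_real_derivative 2 * max 0 x) (at x)"
      using 1 by (auto intro!: derivative_eq_intros)
    then show ?thesis using DERIV_cong_ev[OF refl ev refl] by blast
  next
    case 2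
    then have "eventually (\<lambda>y. y < 0) (nhds x)" using eventually_nhds_in_open[of "{..<0}" x] by simp
    then have ev: "eventually (\<lambda>y. (max 0 y)\<^sup>2 = 0) (nhds x)" by eventually_elim simp
    have "((\<lambda>y. 0) has_real_derivative 2 * max 0 x) (at x)"
      using 2 by (auto intro!: derivative_eq_intros)
    then show ?thesis using DERIV_cong_ev[OF refl ev refl] by blast
  next
    case 3
    have "((\<lambda>h. (max 0 h)\<^sup>2 / h) \<longlongrightarrow> 0) (at (0::real))"
    proof (rule Lim_null_comparison)
      have "norm ((max 0 h)\<^sup>2 / h) \<le> \<bar>h\<bar>" for h :: real
        by (cases "h > 0") (auto simp: power2_eq_square max_def)
      then show "\<forall>\<^sub>F h in at 0. norm ((max 0 h)\<^sup>2 / h) \<le> \<bar>h\<bar>" by simp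
      show "((\<lambda>h. \<bar>h\<bar>) \<longlongrightarrow> 0) (at (0::real))" by (auto intro!: tendsto_eq_intros)
    qed
    then show ?thesis using 3 by (simp add: DERIV_def)
  qed
qed

text \<open>Length is invariant under a monotone change of time by substitution. The speed
  \<open>g'\<close> may vanish, which lets a curve wait at an endpoint.\<close>

lemma reparametrize:
  fixes \<gamma> :: "real \<Rightarrow> 'a::euclidean_space"
  assumes der: "\<forall>t\<in>{0..1}. (\<gamma> has_vector_derivative \<gamma>' t) (at t within {0..1})"
    and cont: "continuous_on {0..1} \<gamma>'"
    and g: "\<And>t. (g has_real_derivative g' t) (at t)" and cg: "continuous_on UNIV g'"
    and pos: "\<And>t. g' t \<ge> 0"
    and range: "g ` {0..1} \<subseteq> {0..1}" and ends: "g 0 = 0" "g 1 = 1"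
  shows "t \<in> {0..1} \<Longrightarrow> ((\<lambda>t. \<gamma> (g t)) has_vector_derivative g' t *\<^sub>R \<gamma>' (g t)) (at t within {0..1})"
    and "continuous_on {0..1} (\<lambda>t. g' t *\<^sub>R \<gamma>' (g t))"
    and "((\<lambda>t. norm (g' t *\<^sub>R \<gamma>' (g t))) has_integral integral {0..1} (\<lambda>t. norm (\<gamma>' t))) {0..1}"
proof -
  show "((\<lambda>t. \<gamma> (g t)) has_vector_derivative g' t *\<^sub>R \<gamma>' (g t)) (at t within {0..1})"
    if t: "t \<in> {0..1}"
  proof -
    have "(\<gamma> has_vector_derivative \<gamma>' (g t)) (at (g t) within g ` {0..1})"
      using der range t by (blast intro: has_vector_derivative_within_subset)
    then have "((\<gamma> \<circ> g) has_vector_derivative g' t *\<^sub>R \<gamma>' (g t)) (at t within {0..1})"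
      by (rule vector_diff_chain_within[OF has_vector_derivative_at_within
            [OF g[unfolded has_real_derivative_iff_has_vector_derivative]]])
    then show ?thesis by (simp add: o_def)
  qed
  have contg: "continuous_on {0..1} g"
    by (rule DERIV_continuous_on[OF has_field_derivative_at_within[OF g]])
  show "continuous_on {0..1} (\<lambda>t. g' t *\<^sub>R \<gamma>' (g t))"
    by (intro continuous_on_scaleR continuous_on_subset[OF cg] continuous_on_compose2[OF cont contg]
        range subset_UNIV)
  have "((\<lambda>t. g' t *\<^sub>R norm (\<gamma>' (g t))) has_integral integral {g 0..g 1} (\<lambda>t. norm (\<gamma>' t))) {0..1}"
  proof (rule has_integral_substitution[of 0 1 g 0 1])
    show "g ` {0..1} \<subseteq> {0..1}" by (rule range)
    show "(g has_real_derivative g' x) (at x within {0..1})" for x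
      by (rule has_field_derivative_at_within[OF g])
  qed (simp_all add: ends continuous_on_norm[OF cont])
  then show "((\<lambda>t. norm (g' t *\<^sub>R \<gamma>' (g t))) has_integral integral {0..1} (\<lambda>t. norm (\<gamma>' t))) {0..1}"
    unfolding ends by (rule has_integral_eq[rotated]) (simp only: norm_scaleR abs_of_nonneg[OF pos] real_scaleR_def)
qed

text \<open>
  The two curves are traversed with speeds that vanish at the time \<open>1/2\<close>, so that the
  concatenation can be written as a sum of differentiable curves.
\<close>

lemma joinable_trans:
  assumes "joinable U V a" "joinable V W b"
  shows "joinable U W (a + b)"
proof -
  obtain \<alpha> \<alpha>' where \<alpha>: "\<forall>t\<in>{0..1}. (\<alpha> has_vector_derivative \<alpha>' t) (at t within {0..1})"
    "\<And>t. t\<in>{0..1} \<Longrightarrow> \<alpha> t \<in> stiefel" "continuous_on {0..1} \<alpha>'" "\<alpha> 0 = U" "\<alpha> 1 = V"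
    "integral {0..1} (\<lambda>t. norm (\<alpha>' t)) \<le> a"
    using assms(1) unfolding joinable_def by blast
  obtain \<beta> \<beta>' where \<beta>: "\<forall>t\<in>{0..1}. (\<beta> has_vector_derivative \<beta>' t) (at t within {0..1})"
    "\<And>t. t\<in>{0..1} \<Longrightarrow> \<beta> t \<in> stiefel" "continuous_on {0..1} \<beta>'" "\<beta> 0 = V" "\<beta> 1 = W"
    "integral {0..1} (\<lambda>t. norm (\<beta>' t)) \<le> b"
    using assms(2) unfolding joinable_def by blast
  define g h :: "real \<Rightarrow> real"
    where "g t = 1 - 4 * (max 0 (1/2 - t))\<^sup>2" and "h t = 4 * (max 0 (t - 1/2))\<^sup>2" for t
  define g' h' :: "real \<Rightarrow> real"
    where "g' t = 8 * max 0 (1/2 - t)" and "h' t = 8 * max 0 (t - 1/2)" for t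
  have "((\<lambda>x. (max 0 (1/2 - x))\<^sup>2) has_real_derivative 2 * max 0 (1/2 - t) * (-1)) (at t)"
    and "((\<lambda>x. (max 0 (x - 1/2))\<^sup>2) has_real_derivative 2 * max 0 (t - 1/2) * 1) (at t)" for t :: real
    by (rule DERIV_chain2[OF has_real_derivative_max_0_square]; auto intro!: derivative_eq_intros)+
  note sq = this
  have der: "(g has_real_derivative g' t) (at t)" "(h has_real_derivative h' t) (at t)" for t
    using DERIV_diff[OF DERIV_const[of 1] DERIV_cmult[OF sq(1)[of t], of 4]]
      DERIV_cmult[OF sq(2)[of t], of 4]
    by (simp_all add: g_def[abs_def] h_def[abs_def] g'_def h'_def)
  have cont: "continuous_on UNIV g'" "continuous_on UNIV h'"
    unfolding g'_def[abs_def] h'_def[abs_def] by (intro continuous_intros)+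
  have sq_le: "(max 0 x)\<^sup>2 \<le> 1/4" if "x \<le> 1/2" for x :: real
    using that power_mono[of "max 0 x" "1/2" 2] by (simp add: power_divide)
  have in01: "g t \<in> {0..1}" "h t \<in> {0..1}" if "t \<in> {0..1}" for t
    using that sq_le[of "1/2 - t"] sq_le[of "t - 1/2"] by (auto simp: g_def h_def)
  then have range: "g ` {0..1} \<subseteq> {0..1}" "h ` {0..1} \<subseteq> {0..1}" by auto
  have ends: "g 0 = 0" "g 1 = 1" "h 0 = 0" "h 1 = 1"
    by (simp_all add: g_def h_def power_divide)
  have pos: "g' t \<ge> 0" "h' t \<ge> 0" for t by (simp_all add: g'_def h'_def)
  note rg = reparametrize[OF \<alpha>(1,3) der(1) cont(1) pos(1) range(1) ends(1,2)]
  note rh = reparametrize[OF \<beta>(1,3) der(2) cont(2) pos(2) range(2) ends(3,4)]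
  \<comment> \<open>On the first half \<open>h\<close> is 0 and the second curve waits at
    \<open>V\<close>; on the second half \<open>g\<close> is 1 and the first one waits there.
    Subtracting \<open>V\<close> leaves the active curve.\<close>
  let ?\<gamma> = "\<lambda>t. \<alpha> (g t) + \<beta> (h t) - V"
  let ?\<gamma>' = "\<lambda>t. g' t *\<^sub>R \<alpha>' (g t) + h' t *\<^sub>R \<beta>' (h t)"
  show ?thesis
    unfolding joinable_def
  proof (rule exI[of _ ?\<gamma>], rule exI[of _ ?\<gamma>'], intro conjI ballI)
    fix t :: real assume t: "t \<in> {0..1}"
    show "(?\<gamma> has_vector_derivative ?\<gamma>' t) (at t within {0..1})"
      using has_vector_derivative_diff[OF has_vector_derivative_add[OF rg(1)[OF t] rh(1)[OF t]]
          has_vector_derivative_const[of V]] by simp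
    show "?\<gamma> t \<in> stiefel"
    proof (cases "t \<le> 1/2")
      case True
      then have "h t = 0" by (simp add: h_def max_absorb1)
      then show ?thesis using \<alpha>(2)[OF in01(1)[OF t]] \<beta>(4) by simp
    next
      case False
      then have "g t = 1" by (simp add: g_def max_absorb1)
      then show ?thesis using \<beta>(2)[OF in01(2)[OF t]] \<alpha>(5) by simp
    qed
  next
    show c: "continuous_on {0..1} ?\<gamma>'" by (intro continuous_intros rg(2) rh(2))
    show "?\<gamma> 0 = U" "?\<gamma> 1 = W" using \<alpha>(4,5) \<beta>(4,5) ends by simp_all
    have "integral {0..1} (\<lambda>t. norm (?\<gamma>' t))
        \<le> integral {0..1} (\<lambda>t. norm (g' t *\<^sub>R \<alpha>' (g t)) + norm (h' t *\<^sub>R \<beta>' (h t)))"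
      by (intro integral_le integrable_continuous_interval continuous_on_norm continuous_on_add
          c rg(2) rh(2) norm_triangle_ineq)
    also have "\<dots> = integral {0..1} (\<lambda>t. norm (\<alpha>' t)) + integral {0..1} (\<lambda>t. norm (\<beta>' t))"
      by (rule integral_unique[OF has_integral_add[OF rg(3) rh(3)]])
    finally show "integral {0..1} (\<lambda>t. norm (?\<gamma>' t)) \<le> a + b" using \<alpha>(6) \<beta>(6) by linarith
  qed
qed

section \<open>The bound by pi / 2 times the chord\<close>

text \<open>Injectivity of \<open>U + V\<close> provides the left inverse and the equality of the
  Gram matrices of \<open>U\<close> and \<open>V\<close> the skewness required by
  \<open>skew_interpolation\<close>. \<open>U\<close> and \<open>V\<close> are then the endpoints in
  \<open>skew_chord\<close> for \<open>Y = U + V\<close> and \<open>A ** Y = V - U\<close>.\<close>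

lemma joinable_chord:
  fixes U V :: "real^'p^'n"
  assumes U: "U \<in> stiefel" and V: "V \<in> stiefel" and inj: "\<And>x. (U + V) *v x = 0 \<Longrightarrow> x = 0"
  shows "joinable U V (pi / 2 * norm (V - U))"
proof -
  obtain P :: "real^'n^'p" where "P ** (U + V) = mat 1"
    using inj matrix_left_invertible_ker[of "U + V"] by blast
  moreover have "transpose (V - U) ** (U + V) = - (transpose (U + V) ** (V - U))"
    using U V by (simp add: stiefel_def transpose_linear matrix_mult_linear)
  ultimately obtain A where A: "transpose A = - A" and AY: "A ** (U + V) = V - U"
    by (rule skew_interpolation)
  have "(1/2) *\<^sub>R ((U + V) - A ** (U + V)) = U" "(1/2) *\<^sub>R ((U + V) + A ** (U + V)) = V"
    unfolding AY by (simp_all add: vec_eq_iff)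
  moreover from this(1) U have "(1/2) *\<^sub>R ((U + V) - A ** (U + V)) \<in> stiefel" by simp
  ultimately obtain \<gamma> \<gamma>' where "\<And>t. (\<gamma> has_vector_derivative \<gamma>' t) (at t)" "continuous_on UNIV \<gamma>'"
    "\<gamma> 0 = U" "\<gamma> 1 = V" "\<And>t. \<gamma> t \<in> stiefel" "\<And>t. norm (\<gamma>' t) \<le> pi / 2 * norm (V - U)"
    using skew_chord[OF A, of "U + V"] by (metis AY)
  then show ?thesis
    using joinable_flow[of \<gamma> \<gamma>' "pi / 2 * norm (V - U)" 1] by simp
qed

text \<open>The map sending \<open>w\<close> to \<open>transpose U *v w\<close> and
  \<open>transpose V *v w\<close> has its range in the hyperplane orthogonal to
  \<open>(y, y)\<close>. Its rank is thus at most 2 p - 1 < n, so it has a nonzero kernel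
  vector.\<close>

lemma exists_orthogonal_unit_vector:
  fixes U V :: "real^'p^'n"
  assumes dim: "CARD('n) \<ge> 2 * CARD('p)" and y: "(U + V) *v y = 0" "y \<noteq> 0"
  obtains w where "norm w = 1" "\<And>x. w \<bullet> (U *v x) = 0" "\<And>x. w \<bullet> (V *v x) = 0"
proof -
  let ?\<Psi> = "\<lambda>w. (transpose U *v w, transpose V *v w)"
  have lin: "linear ?\<Psi>"
    by (rule linearI)
       (simp_all add: matrix_vector_right_distrib matrix_vector_mult_scaleR del: transpose_matrix_vector)
  have adj: "(transpose M *v w) \<bullet> x = w \<bullet> (M *v x)" for M :: "real^'p^'n" and w x
    by (simp add: dot_lmul_matrix)
  have "\<not> inj ?\<Psi>"
  proof
    assume "inj ?\<Psi>"
    then have "dim (range ?\<Psi>) = CARD('n)"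
      using dim_image_eq[OF lin, of UNIV] by simp
    moreover have "dim (range ?\<Psi>) \<le> dim {z. (y, y) \<bullet> z = 0}"
    proof (rule dim_subset, clarsimp simp del: transpose_matrix_vector)
      fix w
      have "y \<bullet> (transpose U *v w) + y \<bullet> (transpose V *v w) = w \<bullet> ((U + V) *v y)"
        by (simp only: inner_commute[of y] adj inner_add_right[symmetric] matrix_vector_mult_add_rdistrib)
      then show "y \<bullet> (transpose U *v w) + y \<bullet> (transpose V *v w) = 0" by (simp add: y(1))
    qed
    moreover have "dim {z. (y, y) \<bullet> z = 0} = 2 * CARD('p) - 1"
      using y(2) by (simp add: dim_hyperplane zero_prod_def)
    ultimately show False using dim by (simp add: zero_less_card_finite) (use zero_less_card_finite[where 'a='p] in linarith)
  qed
  then obtain w where w: "?\<Psi> w = 0" "w \<noteq> 0"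
    using linear_injective_0[OF lin] by auto
  show ?thesis
  proof
    show "norm (w /\<^sub>R norm w) = 1" using w(2) by simp
    show "(w /\<^sub>R norm w) \<bullet> (U *v x) = 0" "(w /\<^sub>R norm w) \<bullet> (V *v x) = 0" for x
      using w(1) adj[of U w x] adj[of V w x] by (simp_all add: zero_prod_def del: transpose_matrix_vector)
  qed
qed

lemma norm_matrix_diff_le_joinable:
  fixes U V :: "real^'p^'n"
  assumes "joinable U V l"
  shows "norm (V - U) \<le> l"
proof -
  obtain \<gamma> \<gamma>' :: "real \<Rightarrow> real^'p^'n" where
    der: "\<And>t. t\<in>{0..1} \<Longrightarrow> (\<gamma> has_vector_derivative \<gamma>' t) (at t within {0..1})"
    and cont: "continuous_on {0..1} \<gamma>'" and ends: "\<gamma> 0 = U" "\<gamma> 1 = V"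
    and l: "integral {0..1} (\<lambda>t. norm (\<gamma>' t)) \<le> l"
    using assms unfolding joinable_def by blast
  have "(\<gamma>' has_integral \<gamma> 1 - \<gamma> 0) {0..1}"
    by (rule fundamental_theorem_of_calculus[OF _ der]) simp_all
  then have "norm (V - U) = norm (integral {0..1} \<gamma>')"
    by (simp add: integral_unique ends)
  also have "\<dots> \<le> integral {0..1} (\<lambda>t. norm (\<gamma>' t))"
    by (intro integral_norm_bound_integral integrable_continuous_interval continuous_on_norm cont)
       simp
  finally show ?thesis using l by linarith
qed

text \<open>
  Rotating the direction \<open>U y\<close> towards a common normal \<open>w\<close> of \<open>U\<close> and \<open>V\<close> removes \<open>y\<close> from the
  kernel of \<open>U + V\<close>.
\<close>

lemma joinable_perturb:
  fixes U V :: "real^'p^'n"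
  assumes U: "U \<in> stiefel" and y: "norm y = 1" "(U + V) *v y = 0"
    and w: "norm w = 1" "\<And>x. w \<bullet> (U *v x) = 0" "\<And>x. w \<bullet> (V *v x) = 0"
  obtains k where "\<And>s. 0 < s \<Longrightarrow> s < pi \<Longrightarrow> \<exists>U'\<in>stiefel. joinable U U' (s * k)
    \<and> {x. (U' + V) *v x = 0} \<subset> {x. (U + V) *v x = 0}"
proof
  \<comment> \<open>The outer products of \<open>U *v y\<close> and of \<open>w\<close> with
    \<open>y\<close>: the curve \<open>\<gamma>\<close> changes only the image of \<open>y\<close>,
    from \<open>U *v y\<close> to cos s times it plus sin s times \<open>w\<close>.\<close>
  define E F :: "real^'p^'n"
    where "E = (\<chi> r i. (U *v y) $ r * y $ i)" and "F = (\<chi> r i. w $ r * y $ i)"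
  define \<gamma> where "\<gamma> s = U + (cos s - 1) *\<^sub>R E + sin s *\<^sub>R F" for s
  define \<gamma>' where "\<gamma>' s = - sin s *\<^sub>R E + cos s *\<^sub>R F" for s
  have colE: "column i E = y $ i *\<^sub>R (U *v y)" and colF: "column i F = y $ i *\<^sub>R w" for i
    by (simp_all add: E_def F_def column_def vec_eq_iff)
  have mulE: "E *v x = (y \<bullet> x) *\<^sub>R (U *v y)" and mulF: "F *v x = (y \<bullet> x) *\<^sub>R w" for x
  proof -
    have "(\<chi> r i. z $ r * y $ i) *v x = (y \<bullet> x) *\<^sub>R z" for z :: "real^'n"
      by (simp add: matrix_vector_mult_def inner_vec_def vec_eq_iff sum_distrib_left mult_ac)
    then show "E *v x = (y \<bullet> x) *\<^sub>R (U *v y)" "F *v x = (y \<bullet> x) *\<^sub>R w"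
      unfolding E_def F_def by blast+
  qed
  have Ucol: "column i U \<bullet> (U *v y) = y $ i" for i
  proof -
    have "column i U \<bullet> (U *v y) = (\<Sum>j\<in>UNIV. y $ j * (column i U \<bullet> column j U))"
      by (simp add: matrix_mult_sum inner_sum_right scalar_mult_eq_scaleR)
    also have "\<dots> = (\<Sum>j\<in>UNIV. y $ j * (if i = j then 1 else 0))"
      using U unfolding stiefel_columns by (simp only:)
    finally show ?thesis by (simp add: if_distrib cong: if_cong)
  qed
  have UyUy: "(U *v y) \<bullet> (U *v y) = 1"
  proof -
    have "(U *v y) \<bullet> (U *v y) = (\<Sum>j\<in>UNIV. y $ j * (column j U \<bullet> (U *v y)))"
      by (subst (1) matrix_mult_sum) (simp add: inner_sum_left scalar_mult_eq_scaleR)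
    also have "\<dots> = y \<bullet> y" unfolding Ucol by (simp add: inner_vec_def)
    finally show ?thesis using y(1) by (simp add: norm_eq_1)
  qed
  have wcol: "w \<bullet> column i U = 0" for i
    using w(2)[of "axis i 1"] by (simp add: matrix_vector_mul_component matrix_vector_mult_basis)
  have st: "\<gamma> s \<in> stiefel" for s
  proof -
    let ?z = "(cos s - 1) *\<^sub>R (U *v y) + sin s *\<^sub>R w"
    have col: "column i (\<gamma> s) = column i U + y $ i *\<^sub>R ?z" for i
      by (simp add: \<gamma>_def vec_eq_iff column_def E_def F_def algebra_simps)
    have cz: "column i U \<bullet> ?z = (cos s - 1) * y $ i" for i
      using Ucol[of i] wcol[of i] by (simp add: inner_add_right inner_commute[of "column i U" w])
    have zz: "?z \<bullet> ?z = (cos s - 1)\<^sup>2 + (sin s)\<^sup>2"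
      using w(1) w(2)[of y] UyUy unfolding norm_eq_1
      by (simp add: inner_add_left inner_add_right inner_commute[of "U *v y" w] power2_eq_square)
    have "column i (\<gamma> s) \<bullet> column j (\<gamma> s) = column i U \<bullet> column j U
        + y $ i * y $ j * (2 * (cos s - 1) + (cos s - 1)\<^sup>2 + (sin s)\<^sup>2)" for i j
    proof -
      have expand: "(a + r *\<^sub>R z) \<bullet> (b + t *\<^sub>R z) = a \<bullet> b + t * (a \<bullet> z) + r * (b \<bullet> z) + r * t * (z \<bullet> z)"
        for a b z :: "real^'n" and r t
        by (simp add: inner_add_left inner_add_right inner_commute[of z b] algebra_simps)
      show ?thesis unfolding col expand[of "column i U" "y $ i" ?z "column j U" "y $ j"] cz zz
        by (simp add: algebra_simps)
    qed
    moreover have "2 * (cos s - 1) + (cos s - 1)\<^sup>2 + (sin s)\<^sup>2 = 0"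
      using sin_cos_squared_add[of s] by (simp add: power2_eq_square algebra_simps)
    ultimately show ?thesis using U by (simp add: stiefel_columns)
  qed
  have der: "(\<gamma> has_vector_derivative \<gamma>' s) (at s)" for s
    unfolding \<gamma>_def \<gamma>'_def by (auto intro!: derivative_eq_intros)
  have cont: "continuous_on UNIV \<gamma>'"
    unfolding \<gamma>'_def[abs_def] by (intro continuous_intros)
  have bd: "norm (\<gamma>' s) \<le> norm E + norm F" for s
  proof -
    have "norm (\<gamma>' s) \<le> \<bar>sin s\<bar> * norm E + \<bar>cos s\<bar> * norm F"
      unfolding \<gamma>'_def by (rule norm_triangle_le) simp
    also have "\<dots> \<le> 1 * norm E + 1 * norm F"
      by (intro add_mono mult_right_mono) auto
    finally show ?thesis by simp
  qed
  fix s :: real assume s: "0 < s" "s < pi"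
  have "joinable (\<gamma> 0) (\<gamma> s) (s * (norm E + norm F))"
    using joinable_flow[OF der cont st bd] s by simp
  then have "joinable U (\<gamma> s) (s * (norm E + norm F))"
    by (simp add: \<gamma>_def)
  moreover have "{x. (\<gamma> s + V) *v x = 0} \<subset> {x. (U + V) *v x = 0}"
  proof
    have mul: "(\<gamma> s + V) *v x = (U + V) *v x + (y \<bullet> x) *\<^sub>R ((cos s - 1) *\<^sub>R (U *v y) + sin s *\<^sub>R w)" for x
      by (simp add: \<gamma>_def matrix_vector_mult_add_rdistrib scaleR_matrix_vector_assoc[symmetric]
          mulE mulF algebra_simps)
    \<comment> \<open>Pairing with \<open>w\<close> removes everything but the rotated part, and sin
      s > 0. Kernel vectors are therefore orthogonal to \<open>y\<close>, and on such vectors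
      \<open>\<gamma> s\<close> agrees with \<open>U\<close>.\<close>
    have yx: "y \<bullet> x = 0" if "(\<gamma> s + V) *v x = 0" for x
    proof -
      have "w \<bullet> ((\<gamma> s + V) *v x) = (y \<bullet> x) * sin s"
        unfolding mul using w(1) w(2,3)
        by (simp add: inner_simps norm_eq_1 matrix_vector_mult_add_rdistrib)
      then show ?thesis using that s sin_gt_zero[of s] by simp
    qed
    show "{x. (\<gamma> s + V) *v x = 0} \<subseteq> {x. (U + V) *v x = 0}"
    proof (rule subsetI, simp only: mem_Collect_eq)
      fix x assume "(\<gamma> s + V) *v x = 0"
      then show "(U + V) *v x = 0" using mul[of x] yx[of x] by simp
    qed
    have "y \<notin> {x. (\<gamma> s + V) *v x = 0}" using yx[of y] y(1) by auto
    then show "{x. (\<gamma> s + V) *v x = 0} \<noteq> {x. (U + V) *v x = 0}" using y(2) by blast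
  qed
  ultimately show "\<exists>U'\<in>stiefel. joinable U U' (s * (norm E + norm F))
    \<and> {x. (U' + V) *v x = 0} \<subset> {x. (U + V) *v x = 0}" using st by blast
qed

text \<open>Induction on the dimension of the kernel of \<open>U + V\<close>: a perturbation of
  arbitrarily small cost strictly shrinks the kernel, and once it is trivial
  \<open>joinable_chord\<close> applies.\<close>

lemma joinable_pi_half:
  fixes U V :: "real^'p^'n"
  assumes dim: "CARD('n) \<ge> 2 * CARD('p)"
    and U: "U \<in> stiefel" and V: "V \<in> stiefel" and \<epsilon>: "\<epsilon> > 0"
  shows "joinable U V (pi / 2 * norm (V - U) + \<epsilon>)"
  using U \<epsilon>
proof (induction "dim {x. (U + V) *v x = 0}" arbitrary: U \<epsilon> rule: less_induct)
  case less
  show ?case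
  proof (cases "\<forall>x. (U + V) *v x = 0 \<longrightarrow> x = 0")
    case True
    then show ?thesis
      using joinable_chord[OF less.prems(1) V] less.prems(2) by (auto intro: joinable_mono)
  next
    case False
    then obtain y0 where y0: "(U + V) *v y0 = 0" "y0 \<noteq> 0" by blast
    obtain w where w: "norm w = 1" "\<And>x. w \<bullet> (U *v x) = 0" "\<And>x. w \<bullet> (V *v x) = 0"
      using exists_orthogonal_unit_vector[OF dim y0] by blast
    have "norm (y0 /\<^sub>R norm y0) = 1" "(U + V) *v (y0 /\<^sub>R norm y0) = 0"
      using y0 by (simp_all add: matrix_vector_mult_scaleR)
    then obtain k where k: "\<And>s. 0 < s \<Longrightarrow> s < pi \<Longrightarrow> \<exists>U'\<in>stiefel. joinable U U' (s * k)
        \<and> {x. (U' + V) *v x = 0} \<subset> {x. (U + V) *v x = 0}"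
      using joinable_perturb[OF less.prems(1) _ _ w] by blast
    \<comment> \<open>A perturbation of size \<open>s\<close> costs at most s |k| for its curve and
      pi / 2 times s |k| for the longer chord. With s K \<le> \<epsilon> / 2 both fit into half the
      slack, the other half being left for the induction; the summand 1 keeps \<open>K\<close>
      positive if \<open>k\<close> is 0.\<close>
    define K where "K = (pi / 2 + 1) * \<bar>k\<bar> + 1"
    have K: "K > 0" unfolding K_def using pi_gt_zero by (intro add_nonneg_pos) auto
    define s where "s = min 1 (\<epsilon> / 2 / K)"
    have "s \<le> 1" "s \<le> \<epsilon> / 2 / K" by (simp_all add: s_def)
    then have s: "0 < s" "s < pi" "s * K \<le> \<epsilon> / 2"
      using K less.prems(2) pi_gt3 by (simp add: s_def, linarith, simp only: pos_le_divide_eq)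
    obtain U' where U': "U' \<in> stiefel" "joinable U U' (s * k)"
      and ker: "{x. (U' + V) *v x = 0} \<subset> {x. (U + V) *v x = 0}"
      using k[OF s(1,2)] by blast
    have sub: "subspace {x. (M::real^'p^'n) *v x = 0}" for M
      by (auto simp: subspace_def matrix_vector_right_distrib matrix_vector_mult_scaleR)
    have "dim {x. (U' + V) *v x = 0} < dim {x. (U + V) *v x = 0}"
      using ker sub by (intro dim_psubset) (simp add: span_eq_iff[THEN iffD2, OF sub])
    from less.hyps[OF this U'(1), of "\<epsilon> / 2"] less.prems(2)
    have "joinable U' V (pi / 2 * norm (V - U') + \<epsilon> / 2)" by simp
    from joinable_trans[OF U'(2) this]
    have "joinable U V (s * k + (pi / 2 * norm (V - U') + \<epsilon> / 2))" .
    moreover have "s * k + (pi / 2 * norm (V - U') + \<epsilon> / 2) \<le> pi / 2 * norm (V - U) + \<epsilon>"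
    proof -
      have sk: "s * k \<le> s * \<bar>k\<bar>" using s(1) by (intro mult_left_mono) auto
      have "norm (V - U') \<le> norm (V - U) + norm (U' - U)"
        using norm_triangle_ineq4[of "V - U" "U' - U"] by simp
      also have "norm (U' - U) \<le> s * \<bar>k\<bar>"
        using norm_matrix_diff_le_joinable[OF U'(2)] sk by linarith
      finally have "pi / 2 * norm (V - U') \<le> pi / 2 * (norm (V - U) + s * \<bar>k\<bar>)"
        by (intro mult_left_mono) auto
      moreover have "s * \<bar>k\<bar> + pi / 2 * (s * \<bar>k\<bar>) \<le> s * K"
        using s(1) by (simp add: K_def algebra_simps)
      ultimately show ?thesis using s(3) sk by (simp add: algebra_simps)
    qed
    ultimately show ?thesis by (rule joinable_mono)
  qed
qed

section \<open>Descent towards a given point\<close>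

lemma inner_matrix_mult:
  fixes M :: "real^'m^'n" and X :: "real^'p^'m" and Y :: "real^'p^'n"
  shows "(M ** X) \<bullet> Y = X \<bullet> (transpose M ** Y)"
proof -
  have "(M ** X) \<bullet> Y = (\<Sum>i\<in>UNIV. \<Sum>j\<in>UNIV. \<Sum>k\<in>UNIV. M $ i $ k * X $ k $ j * Y $ i $ j)"
    by (simp add: inner_vec_def matrix_matrix_mult_def sum_distrib_right)
  also have "\<dots> = (\<Sum>i\<in>UNIV. \<Sum>k\<in>UNIV. \<Sum>j\<in>UNIV. M $ i $ k * X $ k $ j * Y $ i $ j)"
    by (intro sum.cong refl sum.swap)
  also have "\<dots> = (\<Sum>k\<in>UNIV. \<Sum>i\<in>UNIV. \<Sum>j\<in>UNIV. M $ i $ k * X $ k $ j * Y $ i $ j)"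
    by (rule sum.swap)
  also have "\<dots> = (\<Sum>k\<in>UNIV. \<Sum>j\<in>UNIV. \<Sum>i\<in>UNIV. M $ i $ k * X $ k $ j * Y $ i $ j)"
    by (intro sum.cong refl sum.swap)
  also have "\<dots> = X \<bullet> (transpose M ** Y)"
    by (simp add: inner_vec_def matrix_matrix_mult_def transpose_def sum_distrib_left mult_ac)
  finally show ?thesis .
qed

lemma inner_transpose: "transpose X \<bullet> transpose Y = X \<bullet> (Y :: real^'p^'n)"
  unfolding inner_vec_def transpose_def by (simp, rule sum.swap)

text \<open>Cauchy-Schwarz for each entry of the Gram matrix, summed over all entries.\<close>

lemma norm_gram_le:
  fixes Z :: "real^'p^'n"
  shows "norm (transpose Z ** Z) \<le> (norm Z)\<^sup>2"
proof (rule power2_le_imp_le)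
  let ?c = "\<lambda>i. column i Z"
  have "(norm (transpose Z ** Z))\<^sup>2 = (\<Sum>i\<in>UNIV. \<Sum>j\<in>UNIV. (?c i \<bullet> ?c j)\<^sup>2)"
  proof -
    have "column j X \<bullet> column j X = (\<Sum>i\<in>UNIV. (X $ i $ j)\<^sup>2)" for X :: "real^'p^'p" and j
      by (simp add: inner_vec_def column_def power2_eq_square)
    then show ?thesis
      unfolding norm_matrix_columns
      by (simp add: matrix_mult_transpose_dot_column inner_commute)
  qed
  also have "\<dots> \<le> (\<Sum>i\<in>UNIV. \<Sum>j\<in>UNIV. (?c i \<bullet> ?c i) * (?c j \<bullet> ?c j))"
    by (intro sum_mono Cauchy_Schwarz_ineq)
  also have "\<dots> = ((norm Z)\<^sup>2)\<^sup>2"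
    unfolding norm_matrix_columns power2_eq_square[of "sum _ _"] by (simp add: sum_product)
  finally show "(norm (transpose Z ** Z))\<^sup>2 \<le> ((norm Z)\<^sup>2)\<^sup>2" .
qed simp

lemma stiefel_inner_self:
  fixes U :: "real^'p^'n"
  assumes "U \<in> stiefel"
  shows "U \<bullet> U = CARD('p)"
proof -
  have "U \<bullet> U = (\<Sum>i\<in>UNIV. column i U \<bullet> column i U)"
    unfolding norm_matrix_columns[symmetric] by (rule power2_norm_eq_inner[symmetric])
  also have "\<dots> = (\<Sum>i\<in>(UNIV :: 'p set). 1)"
    using assms unfolding stiefel_columns by (intro sum.cong refl) (simp only: simp_thms if_True)
  finally show ?thesis by simp
qed

lemma stiefel_dist:
  fixes U V :: "real^'p^'n"
  assumes "U \<in> stiefel" "V \<in> stiefel"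
  shows "(norm (V - U))\<^sup>2 = 2 * (CARD('p) - U \<bullet> V)"
  using stiefel_inner_self[OF assms(1)] stiefel_inner_self[OF assms(2)]
  by (simp add: power2_norm_eq_inner inner_simps inner_commute)

text \<open>
  \<open>A ** W\<close> is the orthogonal projection of \<open>V\<close> onto the tangent space at \<open>W\<close>, the gradient of
  \<open>W \<mapsto> W \<bullet> V\<close>. With \<open>norm (V - W) = 2 sin (\<theta> / 2)\<close>, that is \<open>x = 1 - cos \<theta>\<close>, its norm is at
  least \<open>sin \<theta>\<close>.
\<close>

lemma stiefel_gradient:
  fixes W V :: "real^'p^'n"
  assumes W: "W \<in> stiefel" and V: "V \<in> stiefel"
  obtains A :: "real^'n^'n" and x where "transpose A = - A" "(norm (V - W))\<^sup>2 = 2 * x"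
    "(A ** W) \<bullet> V = (norm (A ** W))\<^sup>2" "(norm (A ** W))\<^sup>2 \<ge> 2 * x - x\<^sup>2"
proof -
  define Z where "Z = V - W"
  define N where "N = transpose Z ** Z"
  define x where "x = CARD('p) - W \<bullet> V"
  \<comment> \<open>I - N / 2 is the symmetric part of \<open>transpose W ** V\<close>, so G = V - W
    (I - N / 2) is the tangential projection of \<open>V\<close>. Writing it with \<open>Z\<close>
    and \<open>N\<close> makes its norm computable from the chord.\<close>
  define G where "G = Z + (1/2) *\<^sub>R (W ** N)"
  have WW: "transpose W ** W = mat 1" and VV: "transpose V ** V = mat 1"
    using W V by (simp_all add: stiefel_def)
  have N: "N = 2 *\<^sub>R mat 1 - transpose W ** V - transpose V ** W"
    by (simp add: N_def Z_def transpose_linear matrix_mult_linear WW VV algebra_simps scaleR_2)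
  have Nt: "transpose N = N"
    by (simp add: N_def matrix_transpose_mul)
  have nZ: "(norm Z)\<^sup>2 = 2 * x"
    using stiefel_dist[OF W V] by (simp add: Z_def x_def)
  have WG: "transpose W ** G = (1/2) *\<^sub>R (transpose W ** V - transpose V ** W)"
    by (simp add: G_def Z_def matrix_mult_linear matrix_mul_assoc WW) (simp add: N vec_eq_iff algebra_simps)
  have GW: "transpose G ** W = - (transpose W ** G)"
  proof -
    have "transpose G ** W = transpose (transpose W ** G)" by (simp add: matrix_transpose_mul)
    then show ?thesis unfolding WG
      by (simp add: transpose_linear matrix_transpose_mul algebra_simps)
  qed
  obtain A :: "real^'n^'n" where A: "transpose A = - A" "A ** W = G"
    using skew_interpolation[OF WW GW] .
  \<comment> \<open>\<open>transpose W ** G\<close> is skew and hence orthogonal to symmetric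
    matrices, so \<open>G\<close> is orthogonal to the normal part W (I - N / 2) of
    \<open>V\<close>.\<close>
  have sym: "(transpose W ** G) \<bullet> S = 0" if "transpose S = S" for S
  proof -
    have "(transpose W ** G) \<bullet> S = (transpose G ** W) \<bullet> S"
      using inner_transpose[of "transpose W ** G" S] that by (simp add: matrix_transpose_mul)
    then show ?thesis by (simp add: GW)
  qed
  have "G \<bullet> G = G \<bullet> V - G \<bullet> (W ** (mat 1 - (1/2) *\<^sub>R N))"
    by (simp add: G_def Z_def matrix_mult_linear inner_simps)
  also have "G \<bullet> (W ** (mat 1 - (1/2) *\<^sub>R N)) = 0"
    using sym[of "mat 1 - (1/2) *\<^sub>R N"]
    by (simp add: inner_commute[of G] inner_matrix_mult transpose_linear Nt)
  finally have GV: "G \<bullet> V = (norm G)\<^sup>2" by (simp add: power2_norm_eq_inner)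
  have NV: "N \<bullet> (transpose W ** V) = N \<bullet> (mat 1 - (1/2) *\<^sub>R N)"
  proof -
    have "N \<bullet> (transpose V ** W) = N \<bullet> (transpose W ** V)"
      using inner_transpose[of N "transpose W ** V"] by (simp add: Nt matrix_transpose_mul)
    then have "N \<bullet> (transpose W ** V) = (1/2) * (N \<bullet> (transpose W ** V + transpose V ** W))"
      by (simp add: inner_simps)
    also have "transpose W ** V + transpose V ** W = 2 *\<^sub>R (mat 1 - (1/2) *\<^sub>R N)"
      by (simp add: N algebra_simps)
    finally show ?thesis by simp
  qed
  have trN: "N \<bullet> mat 1 = 2 * x"
    by (simp add: N_def inner_matrix_mult nZ[symmetric] power2_norm_eq_inner)
  have "G \<bullet> V = Z \<bullet> V + (1/2) * (N \<bullet> (transpose W ** V))"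
    by (simp add: G_def inner_simps inner_matrix_mult)
  also have "Z \<bullet> V = x"
    by (simp add: Z_def x_def inner_simps stiefel_inner_self[OF V])
  finally have "(norm G)\<^sup>2 = 2 * x - (norm N)\<^sup>2 / 4"
    by (simp add: NV inner_simps trN GV power2_norm_eq_inner[of N])
  \<comment> \<open>By \<open>norm_gram_le\<close>, \<open>N\<close> is no larger than the squared
    chord 2 x, which turns the correction |N|^2 / 4 into at most x^2.\<close>
  moreover have "(norm N)\<^sup>2 \<le> (2 * x)\<^sup>2"
    using norm_gram_le[of Z] by (intro power_mono) (simp_all add: N_def nZ)
  ultimately have "(norm G)\<^sup>2 \<ge> 2 * x - x\<^sup>2" by (simp add: power_mult_distrib)
  then show ?thesis
    using that[OF A(1), of x] A(2) GV nZ by (simp add: Z_def)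
qed

text \<open>Double-angle formula. It trades the \<open>arcsin\<close> of a chord for the
  \<open>arccos\<close> of an expression that is affine in the inner product of the endpoints and so
  easy to differentiate along curves.\<close>

lemma two_arcsin:
  assumes y: "0 \<le> y" "y \<le> 1"
  shows "2 * arcsin y = arccos (1 - 2 * y\<^sup>2)"
proof -
  have "cos (2 * arcsin y) = 1 - 2 * y\<^sup>2"
    using y by (simp add: cos_double_sin)
  moreover have "0 \<le> arcsin y" "arcsin y \<le> pi / 2"
    using y arcsin_bounded[of y] by (simp_all add: arcsin_nonneg)
  ultimately show ?thesis using arccos_cos[of "2 * arcsin y"] by simp
qed

text \<open>Along the flow of the gradient, of speed k, the cosine of \<theta> grows initially at
  rate k^2, so \<theta> falls at rate k^2 / sin \<theta> \<ge> k. The derivative is known only at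
  time 0; the slack \<epsilon> makes that of \<theta> plus (1 - \<epsilon>) times the length
  strictly negative, hence yields a decrease for small positive times.\<close>

lemma stiefel_descent:
  fixes W V :: "real^'p^'n"
  assumes W: "W \<in> stiefel" and V: "V \<in> stiefel" and ne: "W \<noteq> V" and lt: "norm (V - W) < 2"
    and \<epsilon>: "\<epsilon> > 0"
  obtains W' l where "W' \<in> stiefel" "joinable W W' l" "norm (V - W') < norm (V - W)"
    "arccos (1 - (norm (V - W'))\<^sup>2 / 2) + (1 - \<epsilon>) * l < arccos (1 - (norm (V - W))\<^sup>2 / 2)"
proof -
  obtain A :: "real^'n^'n" and x where A: "transpose A = - A" and x: "(norm (V - W))\<^sup>2 = 2 * x"
    and AV: "(A ** W) \<bullet> V = (norm (A ** W))\<^sup>2" and ge: "(norm (A ** W))\<^sup>2 \<ge> 2 * x - x\<^sup>2"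
    using stiefel_gradient[OF W V] by blast
  define k where "k = norm (A ** W)"
  have "0 < (norm (V - W))\<^sup>2" using ne by simp
  moreover have "(norm (V - W))\<^sup>2 < 2\<^sup>2" using lt by (intro power_strict_mono) auto
  ultimately have x01: "0 < x" "x < 2" using x by auto
  have pos: "2 * x - x\<^sup>2 > 0"
    using mult_pos_pos[of x "2 - x"] x01 by (simp add: power2_eq_square algebra_simps)
  \<comment> \<open>This is sin \<theta> for x = 1 - cos \<theta>; it is positive because the chord
    is nonzero and shorter than 2.\<close>
  define s where "s = sqrt (2 * x - x\<^sup>2)"
  have s: "s > 0" "s \<le> k"
    using pos ge by (simp_all add: s_def k_def real_le_lsqrt)
  then have k: "k > 0" by linarith
  obtain \<gamma> \<gamma>' where der: "\<And>t. (\<gamma> has_vector_derivative \<gamma>' t) (at t)" and cont: "continuous_on UNIV \<gamma>'"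
    and \<gamma>0: "\<gamma> 0 = W" "\<gamma>' 0 = A ** W" and st: "\<And>t. \<gamma> t \<in> stiefel"
    and nk: "\<And>t. norm (\<gamma>' t) = norm (A ** W)"
    using skew_flow[OF A W] by blast
  have dist: "1 - (norm (V - \<gamma> t))\<^sup>2 / 2 = 1 - real CARD('p) + \<gamma> t \<bullet> V" for t
    using stiefel_dist[OF st V, of t] by (simp add: field_simps)
  have d1: "((\<lambda>t. 1 - real CARD('p) + \<gamma> t \<bullet> V) has_real_derivative k\<^sup>2) (at 0)"
    using bounded_linear.has_vector_derivative[OF bounded_linear_inner_left der[of 0], of V]
    by (auto intro!: derivative_eq_intros simp: has_real_derivative_iff_has_vector_derivative \<gamma>0 AV k_def)
  have c0: "1 - real CARD('p) + \<gamma> 0 \<bullet> V = 1 - x"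
    using dist[of 0] x \<gamma>0 by simp
  define h where "h t = arccos (1 - real CARD('p) + \<gamma> t \<bullet> V) + (1 - \<epsilon>) * (t * k)" for t
  have s': "sqrt (1 - (1 - x)\<^sup>2) = s"
    by (simp add: s_def power2_eq_square algebra_simps)
  have "((\<lambda>t. arccos (1 - real CARD('p) + \<gamma> t \<bullet> V)) has_real_derivative
      inverse (- sqrt (1 - (1 - x)\<^sup>2)) * k\<^sup>2) (at 0)"
    using DERIV_chain2[OF DERIV_arccos d1, unfolded c0] x01 by simp
  moreover have "((\<lambda>t. (1 - \<epsilon>) * (t * k)) has_real_derivative (1 - \<epsilon>) * k) (at 0)"
    by (auto intro!: derivative_eq_intros)
  ultimately have "(h has_real_derivative inverse (- sqrt (1 - (1 - x)\<^sup>2)) * k\<^sup>2 + (1 - \<epsilon>) * k) (at 0)"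
    unfolding h_def[abs_def]
    by (rule DERIV_add)
  moreover have "inverse (- sqrt (1 - (1 - x)\<^sup>2)) * k\<^sup>2 + (1 - \<epsilon>) * k < 0"
  proof -
    have "k \<le> k\<^sup>2 / s" using s k by (simp add: pos_le_divide_eq power2_eq_square)
    moreover have "\<epsilon> * k > 0" using \<epsilon> k by simp
    ultimately show ?thesis unfolding s' by (simp add: divide_inverse algebra_simps)
  qed
  ultimately have "\<exists>d>0. \<forall>t>0. t < d \<longrightarrow> h (0 + t) < h 0"
    by (rule DERIV_neg_dec_right)
  then obtain a where a: "a > 0" "\<And>t. 0 < t \<Longrightarrow> t < a \<Longrightarrow> h t < h 0"
    by auto
  \<comment> \<open>The cosine itself increases as well, so the chord to \<open>V\<close>
    shrinks.\<close>
  obtain b where b: "b > 0" "\<And>t. 0 < t \<Longrightarrow> t < b \<Longrightarrow> 1 - real CARD('p) + \<gamma> 0 \<bullet> V < 1 - real CARD('p) + \<gamma> t \<bullet> V"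
    using DERIV_pos_inc_right[OF d1] k by auto
  define t where "t = min a b / 2"
  have t: "0 < t" "t < a" "t < b" using a(1) b(1) by (auto simp: t_def)
  show ?thesis
  proof
    show "\<gamma> t \<in> stiefel" by (rule st)
    show "joinable W (\<gamma> t) (t * k)"
      using joinable_flow[OF der cont st, of k t] t nk by (simp add: k_def \<gamma>0)
    have "(norm (V - \<gamma> t))\<^sup>2 < (norm (V - W))\<^sup>2"
      using b(2)[OF t(1,3)] dist[of t] dist[of 0] \<gamma>0 by simp
    then show "norm (V - \<gamma> t) < norm (V - W)" by (rule power2_less_imp_less) simp
    show "arccos (1 - (norm (V - \<gamma> t))\<^sup>2 / 2) + (1 - \<epsilon>) * (t * k) < arccos (1 - (norm (V - W))\<^sup>2 / 2)"
      using a(2)[OF t(1,2)] unfolding h_def dist[symmetric] by (simp add: \<gamma>0)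
  qed
qed

section \<open>The Frobenius geodesic distance and its upper bound\<close>

lemma compact_stiefel: "compact (stiefel :: (real^'p^'n) set)"
proof -
  have "closed {U :: real^'p^'n. \<forall>i j. column i U \<bullet> column j U = (if i = j then 1 else 0)}"
    unfolding column_def
    by (intro closed_Collect_all closed_Collect_eq continuous_intros)
  then have "closed (stiefel :: (real^'p^'n) set)"
    by (simp add: stiefel_columns[symmetric])
  moreover have "norm U \<le> sqrt CARD('p)" if "U \<in> stiefel" for U :: "real^'p^'n"
    using stiefel_inner_self[OF that] by (simp add: norm_eq_sqrt_inner)
  then have "bounded (stiefel :: (real^'p^'n) set)"
    unfolding bounded_iff by blast
  ultimately show ?thesis by (simp add: compact_eq_bounded_closed)
qed

lemma bdd_below_joinable: "bdd_below {l. joinable (U :: real^'p^'n) V l}"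
  by (rule bdd_belowI[of _ 0]) (auto intro: joinable_nonneg)

text \<open>The geodesic distance of the metric with \<open>\<beta> = 1\<close>. The real infimum is
  meaningful because lengths are nonnegative and, by \<open>joinable_ex\<close>, the set is nonempty
  for Stiefel points when n \<ge> 2 p.\<close>

definition frob_dist :: "real^'p^'n \<Rightarrow> real^'p^'n \<Rightarrow> real" where
  "frob_dist U V = Inf {l. joinable U V l}"

lemma frob_dist_le: "joinable U V l \<Longrightarrow> frob_dist U V \<le> (l :: real)"
  unfolding frob_dist_def by (intro cInf_lower bdd_below_joinable) simp

context
  assumes dim: "CARD('n::finite) \<ge> 2 * CARD('p::finite)"
begin

lemma joinable_ex:
  fixes U W :: "real^'p^'n"
  assumes "U \<in> stiefel" "W \<in> stiefel"
  shows "{l. joinable U W l} \<noteq> {}"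
  using joinable_pi_half[OF dim assms, of 1] by auto

lemma joinable_frob_dist:
  fixes U W :: "real^'p^'n"
  assumes "U \<in> stiefel" "W \<in> stiefel" "frob_dist U W < l"
  shows "joinable U W l"
proof -
  obtain m where "joinable U W m" "m < l"
    using cInf_lessD[OF joinable_ex[OF assms(1,2)]] assms(3) unfolding frob_dist_def by blast
  then show ?thesis by (auto intro: joinable_mono)
qed

lemma frob_dist_nonneg:
  fixes U W :: "real^'p^'n"
  assumes "U \<in> stiefel" "W \<in> stiefel"
  shows "frob_dist U W \<ge> 0"
  unfolding frob_dist_def using joinable_ex[OF assms]
  by (intro cInf_greatest) (auto intro: joinable_nonneg)

lemma frob_dist_pi_half:
  fixes U W :: "real^'p^'n"
  assumes "U \<in> stiefel" "W \<in> stiefel"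
  shows "frob_dist U W \<le> pi / 2 * norm (W - U)"
  by (rule field_le_epsilon) (intro frob_dist_le joinable_pi_half dim assms)

lemma frob_dist_triangle:
  fixes U U' W :: "real^'p^'n"
  assumes "U \<in> stiefel" "U' \<in> stiefel" "joinable U' W l"
  shows "frob_dist U W \<le> frob_dist U U' + l"
proof (rule field_le_epsilon)
  fix e :: real assume "e > 0"
  then have "joinable U U' (frob_dist U U' + e)"
    by (intro joinable_frob_dist assms) simp
  from frob_dist_le[OF joinable_trans[OF this assms(3)]]
  show "frob_dist U W \<le> frob_dist U U' + l + e" by simp
qed

text \<open>Two points are joined by a curve of length at most about pi / 2 times their chord, so
  the triangle inequality makes the distance Lipschitz with constant 2.\<close>

lemma continuous_frob_dist:
  fixes U :: "real^'p^'n"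
  assumes U: "U \<in> stiefel"
  shows "continuous_on stiefel (frob_dist U)"
proof (rule continuous_onI)
  have le: "frob_dist U W \<le> frob_dist U W' + 2 * norm (W - W')" if "W \<in> stiefel" "W' \<in> stiefel" for W W'
  proof (rule field_le_epsilon)
    fix e :: real assume e: "e > 0"
    have "pi / 2 * norm (W - W') \<le> 2 * norm (W - W')"
      using pi_less_4 by (intro mult_right_mono) auto
    with frob_dist_triangle[OF U that(2) joinable_pi_half[OF dim that(2,1) e]]
    show "frob_dist U W \<le> frob_dist U W' + 2 * norm (W - W') + e" by linarith
  qed
  fix W :: "real^'p^'n" and e :: real assume W: "W \<in> stiefel" "e > 0"
  show "\<exists>d>0. \<forall>W'\<in>stiefel. dist W' W < d \<longrightarrow> dist (frob_dist U W') (frob_dist U W) \<le> e"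
  proof (intro exI[of _ "e / 2"] conjI ballI impI)
    fix W' :: "real^'p^'n" assume "W' \<in> stiefel" "dist W' W < e / 2"
    then show "dist (frob_dist U W') (frob_dist U W) \<le> e"
      using le[of W W'] le[of W' W] W(1) by (simp add: dist_norm norm_minus_commute abs_le_iff)
  qed (use W in simp)
qed

text \<open>
  Ekeland-type argument: a minimiser of the distance to \<open>V\<close> plus the weighted path length from \<open>U\<close>
  admits no descent, hence is \<open>V\<close> itself.
\<close>

lemma frob_dist_arccos:
  fixes U V :: "real^'p^'n"
  assumes U: "U \<in> stiefel" and V: "V \<in> stiefel" and lt: "norm (V - U) < 2"
  shows "frob_dist U V \<le> arccos (1 - (norm (V - U))\<^sup>2 / 2)"
proof -
  let ?f = "\<lambda>W. arccos (1 - (norm (V - W))\<^sup>2 / 2)"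
  \<comment> \<open>The ball keeps all chords to \<open>V\<close> below 2, as
    \<open>stiefel_descent\<close> demands, and a descent step stays inside it because it shortens
    the chord.\<close>
  let ?K = "stiefel \<inter> cball V (norm (V - U))"
  have "compact ?K" by (intro compact_Int_closed compact_stiefel closed_cball)
  have "U \<in> ?K" using U by (simp add: dist_norm)
  have contf: "continuous_on ?K ?f"
  proof (rule continuous_on_arccos)
    show "\<forall>W\<in>?K. -1 \<le> 1 - (norm (V - W))\<^sup>2 / 2 \<and> 1 - (norm (V - W))\<^sup>2 / 2 \<le> 1"
    proof
      fix W assume "W \<in> ?K"
      then have "(norm (V - W))\<^sup>2 \<le> 2\<^sup>2"
        using lt by (intro power_mono) (auto simp: dist_norm)
      then show "-1 \<le> 1 - (norm (V - W))\<^sup>2 / 2 \<and> 1 - (norm (V - W))\<^sup>2 / 2 \<le> 1" by simp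
    qed
  qed (intro continuous_intros, simp)
  have step: "(1 - \<epsilon>) * frob_dist U V \<le> ?f U" if \<epsilon>: "0 < \<epsilon>" "\<epsilon> < 1" for \<epsilon>
  proof -
    let ?g = "\<lambda>W. ?f W + (1 - \<epsilon>) * frob_dist U W"
    have "continuous_on ?K ?g"
      by (intro continuous_intros contf continuous_on_subset[OF continuous_frob_dist[OF U]]) auto
    then obtain W where W: "W \<in> ?K" and min: "\<And>W'. W' \<in> ?K \<Longrightarrow> ?g W \<le> ?g W'"
      using continuous_attains_inf[OF \<open>compact ?K\<close>, of ?g] \<open>U \<in> ?K\<close> by blast
    have "W = V"
    proof (rule ccontr)
      assume ne: "W \<noteq> V"
      have "norm (V - W) < 2" using W lt by (simp add: dist_norm)
      then obtain W' l where W': "W' \<in> stiefel" "joinable W W' l" "norm (V - W') < norm (V - W)"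
        "?f W' + (1 - \<epsilon>) * l < ?f W"
        using stiefel_descent[OF _ V ne _ \<epsilon>(1)] W by blast
      have "W' \<in> ?K" using W W'(1,3) by (simp add: dist_norm)
      have "(1 - \<epsilon>) * frob_dist U W' \<le> (1 - \<epsilon>) * (frob_dist U W + l)"
        using frob_dist_triangle[OF U _ W'(2)] W \<epsilon> by (intro mult_left_mono) auto
      then have "?g W' < ?g W" using W'(4) by (simp add: distrib_left)
      with min[OF \<open>W' \<in> ?K\<close>] show False by simp
    qed
    \<comment> \<open>At \<open>V\<close> the angle is arccos 1 = 0, at \<open>U\<close> the
      distance to \<open>U\<close> is 0; what remains is the claim up to the factor 1 -
      \<epsilon>.\<close>
    then have "?g V \<le> ?g U" using min[OF \<open>U \<in> ?K\<close>] by simp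
    moreover have "frob_dist U U \<le> 0" using frob_dist_pi_half[OF U U] by simp
    then have "frob_dist U U = 0" using frob_dist_nonneg[OF U U] by linarith
    ultimately show ?thesis by simp
  qed
  have "((\<lambda>\<epsilon>. (1 - \<epsilon>) * frob_dist U V) \<longlongrightarrow> (1 - 0) * frob_dist U V) (at_right 0)"
    by (intro tendsto_intros)
  moreover have "eventually (\<lambda>\<epsilon>::real. (1 - \<epsilon>) * frob_dist U V \<le> ?f U) (at_right 0)"
    unfolding eventually_at_right_field using step by (intro exI[of _ 1]) auto
  ultimately show ?thesis
    using tendsto_upperbound[of _ _ "at_right (0::real)"] by fastforce
qed

lemma frob_dist_M_hat:
  fixes U V :: "real^'p^'n"
  assumes U: "U \<in> stiefel" and V: "V \<in> stiefel"
  shows "frob_dist U V \<le> M_hat 1 (norm (V - U))"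
proof (cases "norm (V - U) < 2")
  case True
  let ?y = "norm (V - U) / 2"
  have "2 * arcsin ?y = arccos (1 - (norm (V - U))\<^sup>2 / 2)"
    using two_arcsin[of ?y] True by (simp add: power_divide)
  then show ?thesis using frob_dist_arccos[OF U V True] True by (simp add: M_hat_def)
next
  case False
  \<comment> \<open>At chord length exactly 2 both branches of \<open>M_hat\<close> equal pi, so the
    boundary case is covered by the chord bound.\<close>
  then have "M_hat 1 (norm (V - U)) = pi / 2 * norm (V - U)"
    by (cases "norm (V - U) = 2") (simp_all add: M_hat_def)
  then show ?thesis using frob_dist_pi_half[OF U V] by simp
qed

end

section \<open>Comparison with the beta-metric\<close>

lemma beta_inner_self:
  fixes U D :: "real^'p^'n"
  shows "beta_inner \<beta> U D D = (norm D)\<^sup>2 - (1 - \<beta>) * (norm (transpose U ** D))\<^sup>2"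
proof -
  have tr: "trace (transpose X ** Y) = X \<bullet> Y" for X Y :: "real^'a^'b"
    unfolding inner_vec_def trace_def matrix_matrix_mult_def transpose_def
    by (simp, rule sum.swap)
  have "beta_inner \<beta> U D D = D \<bullet> ((mat 1 - (1 - \<beta>) *\<^sub>R (U ** transpose U)) ** D)"
    unfolding beta_inner_def matrix_mul_assoc[symmetric] by (rule tr)
  also have "\<dots> = D \<bullet> D - (1 - \<beta>) * (D \<bullet> (U ** (transpose U ** D)))"
    by (simp add: matrix_mult_linear matrix_mul_assoc inner_simps)
  also have "D \<bullet> (U ** (transpose U ** D)) = (transpose U ** D) \<bullet> (transpose U ** D)"
    using inner_matrix_mult[of U "transpose U ** D" D] by (simp add: inner_commute)
  finally show ?thesis by (simp only: power2_norm_eq_inner)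
qed

text \<open>Multiplication by \<open>U\<close> is isometric, so its adjoint does not increase
  norms.\<close>

lemma norm_transpose_mult_stiefel_le:
  fixes U D :: "real^'p^'n"
  assumes "U \<in> stiefel"
  shows "norm (transpose U ** D) \<le> norm D"
proof -
  let ?X = "transpose U ** D"
  have "norm (U ** ?X) = norm ?X"
    using assms inner_matrix_mult[of U ?X "U ** ?X"] matrix_mul_assoc[of "transpose U" U ?X]
    by (simp add: norm_eq_sqrt_inner stiefel_def)
  moreover have "?X \<bullet> ?X = D \<bullet> (U ** ?X)"
    using inner_matrix_mult[of U ?X D] by (simp add: inner_commute)
  ultimately have "norm ?X * norm ?X \<le> norm D * norm ?X"
    using norm_cauchy_schwarz[of D "U ** ?X"]
    by (simp add: power2_norm_eq_inner[symmetric] power2_eq_square[of "norm ?X"])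
  then show ?thesis
    by (cases "norm ?X = 0") (auto simp: mult_le_cancel_right)
qed

text \<open>The squared \<beta>-norm is affine in the squared norm of
  \<open>transpose U ** D\<close>, which ranges between 0 and |D|^2; at these extremes it equals
  |D|^2 and \<beta> |D|^2.\<close>

lemma beta_norm_bounds:
  fixes U D :: "real^'p^'n"
  assumes U: "U \<in> stiefel" and \<beta>: "\<beta> > 0"
  shows "min 1 (sqrt \<beta>) * norm D \<le> beta_norm \<beta> U D" "beta_norm \<beta> U D \<le> max 1 (sqrt \<beta>) * norm D"
proof -
  let ?a = "(norm D)\<^sup>2" and ?b = "(norm (transpose U ** D))\<^sup>2"
  have b: "0 \<le> ?b" "?b \<le> ?a"
    using norm_transpose_mult_stiefel_le[OF U, of D] by (auto intro: power_mono)
  have sq: "beta_norm \<beta> U D = sqrt (?a - (1 - \<beta>) * ?b)"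
    by (simp add: beta_norm_def beta_inner_self)
  have "min 1 \<beta> * ?a \<le> ?a - (1 - \<beta>) * ?b"
  proof (cases "\<beta> \<le> 1")
    case True
    then show ?thesis using mult_left_mono[OF b(2), of "1 - \<beta>"] by (simp add: algebra_simps min_def)
  next
    case False
    then show ?thesis using mult_nonneg_nonneg[of "\<beta> - 1" ?b] b(1) by (simp add: algebra_simps min_def)
  qed
  then show "min 1 (sqrt \<beta>) * norm D \<le> beta_norm \<beta> U D"
    unfolding sq using \<beta> by (intro real_le_rsqrt) (auto simp: power_mult_distrib min_def split: if_splits)
  have "?a - (1 - \<beta>) * ?b \<le> max 1 \<beta> * ?a"
  proof (cases "\<beta> \<le> 1")
    case True
    then show ?thesis using mult_nonneg_nonneg[of "1 - \<beta>" ?b] b(1) by (simp add: max_def)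
  next
    case False
    then show ?thesis using mult_left_mono[OF b(2), of "\<beta> - 1"] by (simp add: algebra_simps max_def)
  qed
  then show "beta_norm \<beta> U D \<le> max 1 (sqrt \<beta>) * norm D"
    unfolding sq using \<beta> by (intro real_le_lsqrt) (auto simp: power_mult_distrib max_def split: if_splits)
qed

lemma velocity_eq:
  assumes "(\<gamma> has_vector_derivative d) (at t within {0..1})" and "t \<in> {0..1}"
  shows "velocity \<gamma> t = d"
  unfolding velocity_def
  using vector_derivative_within_cbox[of 0 1 t \<gamma> d] assms by simp

lemma continuous_on_beta_norm:
  fixes \<gamma> \<gamma>' :: "real \<Rightarrow> real^'p^'n"
  assumes "continuous_on S \<gamma>" "continuous_on S \<gamma>'"
  shows "continuous_on S (\<lambda>t. beta_norm \<beta> (\<gamma> t) (\<gamma>' t))"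
  unfolding beta_norm_def beta_inner_self power2_norm_eq_inner inner_vec_def
    matrix_matrix_mult_def transpose_def
  by (simp, intro continuous_intros assms)

lemma stiefel_curveD:
  fixes \<gamma> :: "real \<Rightarrow> real^'p^'n"
  assumes "\<gamma> \<in> stiefel_curves"
  shows "\<And>t. t \<in> {0..1} \<Longrightarrow> (\<gamma> has_vector_derivative velocity \<gamma> t) (at t within {0..1})"
    and "continuous_on {0..1} (velocity \<gamma>)" and "\<And>t. t \<in> {0..1} \<Longrightarrow> \<gamma> t \<in> stiefel"
  using assms unfolding stiefel_curves_def C1_curve_def differentiable_on_def velocity_def
  by (auto simp: vector_derivative_works)

lemma beta_dist_le_joinable:
  fixes U V :: "real^'p^'n"
  assumes "joinable U V l" and \<beta>: "\<beta> > 0"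
  shows "beta_dist \<beta> U V \<le> ereal (max 1 (sqrt \<beta>) * l)"
proof -
  obtain \<gamma> \<gamma>' :: "real \<Rightarrow> real^'p^'n" where
    der: "\<And>t. t\<in>{0..1} \<Longrightarrow> (\<gamma> has_vector_derivative \<gamma>' t) (at t within {0..1})"
    and st: "\<And>t. t\<in>{0..1} \<Longrightarrow> \<gamma> t \<in> stiefel"
    and cont: "continuous_on {0..1} \<gamma>'" and ends: "\<gamma> 0 = U" "\<gamma> 1 = V"
    and l: "integral {0..1} (\<lambda>t. norm (\<gamma>' t)) \<le> l"
    using assms(1) unfolding joinable_def by blast
  have vel: "velocity \<gamma> t = \<gamma>' t" if "t \<in> {0..1}" for t
    using velocity_eq[OF der] that by blast
  have "\<gamma> differentiable_on {0..1}"
    unfolding differentiable_on_def using der by (meson differentiableI_vector)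
  moreover have "continuous_on {0..1} (velocity \<gamma>)"
    by (rule continuous_on_eq[OF cont]) (simp add: vel)
  ultimately have "\<gamma> \<in> {\<gamma> \<in> stiefel_curves. \<gamma> 0 = U \<and> \<gamma> 1 = V}"
    using st ends by (auto simp: stiefel_curves_def C1_curve_def)
  then have "beta_dist \<beta> U V \<le> ereal (beta_length \<beta> \<gamma>)"
    unfolding beta_dist_def by (rule INF_lower)
  also have "beta_length \<beta> \<gamma> \<le> max 1 (sqrt \<beta>) * l"
  proof -
    have cg: "continuous_on {0..1} \<gamma>"
      using der has_vector_derivative_continuous continuous_on_eq_continuous_within by blast
    have "beta_length \<beta> \<gamma> = integral {0..1} (\<lambda>t. beta_norm \<beta> (\<gamma> t) (\<gamma>' t))"
      unfolding beta_length_def by (rule integral_cong) (simp add: vel)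
    also have "\<dots> \<le> integral {0..1} (\<lambda>t. max 1 (sqrt \<beta>) * norm (\<gamma>' t))"
      by (intro integral_le integrable_continuous_interval continuous_on_beta_norm cg cont
          continuous_intros beta_norm_bounds(2) st \<beta>)
    also have "\<dots> = max 1 (sqrt \<beta>) * integral {0..1} (\<lambda>t. norm (\<gamma>' t))" by simp
    also have "\<dots> \<le> max 1 (sqrt \<beta>) * l" using l by (intro mult_left_mono) auto
    finally show ?thesis .
  qed
  finally show ?thesis by simp
qed

section \<open>The lower bound by arcs on the sphere\<close>

text \<open>
  Shrinking the inner product by \<open>c < 1\<close> keeps the argument of \<open>arccos\<close> away from the endpoints of its
  domain, where it is not differentiable.
\<close>

lemma angle_le_length:
  fixes \<gamma> \<gamma>' :: "real \<Rightarrow> 'a::euclidean_space"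
  assumes der: "\<And>t. t \<in> {0..1} \<Longrightarrow> (\<gamma> has_vector_derivative \<gamma>' t) (at t within {0..1})"
    and cont: "continuous_on {0..1} \<gamma>'" and sphere: "\<And>t. t \<in> {0..1} \<Longrightarrow> norm (\<gamma> t) = 1"
  shows "arccos (\<gamma> 0 \<bullet> \<gamma> 1) \<le> integral {0..1} (\<lambda>t. norm (\<gamma>' t))"
proof -
  let ?a = "\<gamma> 0" and ?L = "integral {0..1} (\<lambda>t. norm (\<gamma>' t))"
  have a: "norm ?a = 1" using sphere[of 0] by simp
  have abs1: "\<bar>?a \<bullet> \<gamma> t\<bar> \<le> 1" if "t \<in> {0..1}" for t
    using Cauchy_Schwarz_ineq2[of ?a "\<gamma> t"] a sphere[OF that] by simp
  have key: "arccos (c * (?a \<bullet> \<gamma> 1)) - arccos (c * (?a \<bullet> \<gamma> 0)) \<le> ?L" if c: "0 < c" "c < 1" for c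
  proof -
    let ?f = "\<lambda>t. c * (?a \<bullet> \<gamma> t)"
    let ?g = "\<lambda>t. inverse (- sqrt (1 - (?f t)\<^sup>2)) * (c * (?a \<bullet> \<gamma>' t))"
    have f1: "\<bar>?f t\<bar> < 1" if "t \<in> {0..1}" for t
    proof -
      have "\<bar>?f t\<bar> \<le> c * 1"
        using abs1[OF that] c by (simp add: abs_mult)
      then show ?thesis using c by linarith
    qed
    have "((\<lambda>t. arccos (?f t)) has_vector_derivative ?g t) (at t within {0..1})" if t: "t \<in> {0..1}" for t
    proof -
      have "(?f has_real_derivative c * (?a \<bullet> \<gamma>' t)) (at t within {0..1})"
        using bounded_linear.has_vector_derivative[OF bounded_linear_inner_right der[OF t], of ?a]
        by (intro DERIV_cmult) (simp add: has_real_derivative_iff_has_vector_derivative)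
      then have "((\<lambda>t. arccos (?f t)) has_real_derivative ?g t) (at t within {0..1})"
        using f1[OF t] by (intro DERIV_chain2[OF DERIV_arccos]) (auto simp: abs_less_iff)
      then show ?thesis by (simp add: has_real_derivative_iff_has_vector_derivative)
    qed
    then have I: "(?g has_integral arccos (?f 1) - arccos (?f 0)) {0..1}"
      by (intro fundamental_theorem_of_calculus) auto
    have "?g t \<le> norm (\<gamma>' t)" if t: "t \<in> {0..1}" for t
    proof -
      have f2: "(?f t)\<^sup>2 < 1" using f1[OF t] by (simp add: abs_square_less_1)
      have "\<gamma>' t \<bullet> \<gamma> t = 0"
      proof -
        have "((\<lambda>s. \<gamma> s \<bullet> \<gamma> s) has_vector_derivative \<gamma> t \<bullet> \<gamma>' t + \<gamma>' t \<bullet> \<gamma> t) (at t within {0..1})"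
          by (rule bounded_bilinear.has_vector_derivative[OF bounded_bilinear_inner der[OF t] der[OF t]])
        moreover have "((\<lambda>s. \<gamma> s \<bullet> \<gamma> s) has_vector_derivative 0) (at t within {0..1})"
          by (rule has_vector_derivative_transform[OF t _ has_vector_derivative_const[of 1]])
             (use sphere in \<open>simp add: norm_eq_1\<close>)
        ultimately have "\<gamma> t \<bullet> \<gamma>' t + \<gamma>' t \<bullet> \<gamma> t = 0"
          using t by (intro vector_derivative_unique_within[of t "{0..1}"])
            (auto simp: trivial_limit_within islimpt_Icc)
        then show ?thesis by (simp add: inner_commute)
      qed
      \<comment> \<open>The velocity is orthogonal to \<open>\<gamma> t\<close>, so only the part of
        \<open>?a\<close> orthogonal to \<open>\<gamma> t\<close> counts; its norm is the sine of
        the angle between them.\<close>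
      then have "?a \<bullet> \<gamma>' t = (?a - (?a \<bullet> \<gamma> t) *\<^sub>R \<gamma> t) \<bullet> \<gamma>' t"
        by (simp add: inner_simps inner_commute)
      then have "\<bar>?a \<bullet> \<gamma>' t\<bar> \<le> norm (?a - (?a \<bullet> \<gamma> t) *\<^sub>R \<gamma> t) * norm (\<gamma>' t)"
        using Cauchy_Schwarz_ineq2 by metis
      also have "norm (?a - (?a \<bullet> \<gamma> t) *\<^sub>R \<gamma> t) = sqrt (1 - (?a \<bullet> \<gamma> t)\<^sup>2)"
        using a sphere[OF t] unfolding norm_eq_1
        by (simp add: norm_eq_sqrt_inner inner_simps inner_commute power2_eq_square)
      finally have "c * \<bar>?a \<bullet> \<gamma>' t\<bar> \<le> 1 * (sqrt (1 - (?a \<bullet> \<gamma> t)\<^sup>2) * norm (\<gamma>' t))"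
        using c by (intro mult_mono) auto
      \<comment> \<open>Shrinking by \<open>c\<close> only enlarges the square root that becomes the
        denominator.\<close>
      also have "\<dots> \<le> sqrt (1 - (?f t)\<^sup>2) * norm (\<gamma>' t)"
      proof -
        have "(?f t)\<^sup>2 \<le> 1 * (?a \<bullet> \<gamma> t)\<^sup>2"
          unfolding power_mult_distrib using c by (intro mult_right_mono) (auto simp: power_le_one)
        then show ?thesis
          unfolding mult_1_left by (intro mult_right_mono real_sqrt_le_mono) simp_all
      qed
      finally have "c * \<bar>?a \<bullet> \<gamma>' t\<bar> / sqrt (1 - (?f t)\<^sup>2) \<le> norm (\<gamma>' t)"
        using f2 by (simp add: pos_divide_le_eq mult.commute)
      moreover have "?g t \<le> c * \<bar>?a \<bullet> \<gamma>' t\<bar> / sqrt (1 - (?f t)\<^sup>2)"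
      proof -
        have "?g t \<le> \<bar>?g t\<bar>" by (rule abs_ge_self)
        also have "\<dots> = c * \<bar>?a \<bullet> \<gamma>' t\<bar> / sqrt (1 - (?f t)\<^sup>2)"
          using c f2 by (simp add: abs_mult divide_inverse)
        finally show ?thesis .
      qed
      ultimately show ?thesis by linarith
    qed
    then show ?thesis
      using has_integral_le[OF I integrable_integral[OF integrable_continuous_interval
          [OF continuous_on_norm[OF cont]]]] by blast
  qed
  \<comment> \<open>Let c tend to 1 from below; the subtracted term tends to arccos 1 = 0.\<close>
  have "((\<lambda>c. arccos (c * (?a \<bullet> \<gamma> 1)) - arccos (c * (?a \<bullet> \<gamma> 0)))
      \<longlongrightarrow> arccos (1 * (?a \<bullet> \<gamma> 1)) - arccos (1 * (?a \<bullet> \<gamma> 0))) (at 1 within {0..1})"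
  proof -
    have "continuous_on {0..1} (\<lambda>c. arccos (c * (?a \<bullet> \<gamma> t)))" if t: "t \<in> {0..1}" for t
    proof (rule continuous_on_arccos)
      show "\<forall>c\<in>{0..1}. -1 \<le> c * (?a \<bullet> \<gamma> t) \<and> c * (?a \<bullet> \<gamma> t) \<le> 1"
      proof
        fix c :: real assume "c \<in> {0..1}"
        then have "\<bar>c * (?a \<bullet> \<gamma> t)\<bar> \<le> 1 * 1"
          unfolding abs_mult using abs1[OF t] by (intro mult_mono) auto
        then show "-1 \<le> c * (?a \<bullet> \<gamma> t) \<and> c * (?a \<bullet> \<gamma> t) \<le> 1" by (simp add: abs_le_iff)
      qed
    qed (intro continuous_intros)
    then have "((\<lambda>c. arccos (c * (?a \<bullet> \<gamma> t))) \<longlongrightarrow> arccos (1 * (?a \<bullet> \<gamma> t))) (at 1 within {0..1})"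
      if "t \<in> {0..1}" for t
      using that unfolding continuous_on_def by (meson atLeastAtMost_iff order_refl zero_le_one)
    then show ?thesis by (intro tendsto_diff) simp_all
  qed
  moreover have "eventually (\<lambda>c::real. arccos (c * (?a \<bullet> \<gamma> 1)) - arccos (c * (?a \<bullet> \<gamma> 0)) \<le> ?L)
      (at 1 within {0..1})"
    unfolding eventually_at using key by (intro exI[of _ 1]) (auto simp: dist_real_def)
  moreover have "at (1::real) within {0..1} \<noteq> bot"
    by (simp add: trivial_limit_within islimpt_Icc)
  ultimately have "arccos (1 * (?a \<bullet> \<gamma> 1)) - arccos (1 * (?a \<bullet> \<gamma> 0)) \<le> ?L"
    by (rule tendsto_upperbound)
  then show ?thesis using a by (simp add: norm_eq_1)
qed

text \<open>Dividing by r = sqrt p moves the curve to the unit sphere, where endpoints at chord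
  distance 2 y span the angle 2 arcsin y; scaling back multiplies it by r.\<close>

lemma m_hat_le_length:
  fixes \<gamma> :: "real \<Rightarrow> real^'p^'n"
  assumes \<gamma>: "\<gamma> \<in> stiefel_curves" "\<gamma> 0 = V" "\<gamma> 1 = U" and \<beta>: "\<beta> > 0"
  shows "m_hat CARD('p) \<beta> (norm (V - U)) \<le> beta_length \<beta> \<gamma>"
proof -
  define r where "r = sqrt (real CARD('p))"
  have r: "r > 0" "r\<^sup>2 = real CARD('p)" by (simp_all add: r_def)
  note c = stiefel_curveD[OF \<gamma>(1)]
  have st: "V \<in> stiefel" "U \<in> stiefel" using c(3)[of 0] c(3)[of 1] \<gamma>(2,3) by auto
  have nr: "norm W = r" if "W \<in> stiefel" for W :: "real^'p^'n"
    using stiefel_inner_self[OF that] by (simp add: norm_eq_sqrt_inner r_def)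
  let ?y = "norm (V - U) / (2 * r)"
  have y: "0 \<le> ?y" "?y \<le> 1"
    using norm_triangle_ineq4[of V U] nr[OF st(1)] nr[OF st(2)] r(1) by simp_all
  have "arccos ((\<gamma> 0 /\<^sub>R r) \<bullet> (\<gamma> 1 /\<^sub>R r)) \<le> integral {0..1} (\<lambda>t. norm (velocity \<gamma> t /\<^sub>R r))"
  proof (rule angle_le_length)
    show "((\<lambda>t. \<gamma> t /\<^sub>R r) has_vector_derivative velocity \<gamma> t /\<^sub>R r) (at t within {0..1})"
      if "t \<in> {0..1}" for t
      by (rule bounded_linear.has_vector_derivative[OF bounded_linear_scaleR_right c(1)[OF that]])
    show "continuous_on {0..1} (\<lambda>t. velocity \<gamma> t /\<^sub>R r)"
      by (intro continuous_on_scaleR continuous_on_const c(2))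
    show "norm (\<gamma> t /\<^sub>R r) = 1" if "t \<in> {0..1}" for t
      using nr[OF c(3)[OF that]] r(1) by simp
  qed
  also have "\<dots> = integral {0..1} (\<lambda>t. norm (velocity \<gamma> t)) / r"
    using r(1) by (simp add: divide_inverse mult.commute)
  also have "(\<gamma> 0 /\<^sub>R r) \<bullet> (\<gamma> 1 /\<^sub>R r) = 1 - 2 * ?y\<^sup>2"
  proof -
    have "(norm (V - U))\<^sup>2 = 2 * (r\<^sup>2 - U \<bullet> V)" using stiefel_dist[OF st(2,1)] r(2) by simp
    then have "2 * ?y\<^sup>2 = 1 - (U \<bullet> V) / r\<^sup>2"
      using r(1) by (simp add: power_divide power_mult_distrib diff_divide_distrib)
    also have "\<dots> = 1 - (V \<bullet> U) / r\<^sup>2" by (simp only: inner_commute)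
    finally have "2 * ?y\<^sup>2 = 1 - (V \<bullet> U) / r\<^sup>2" .
    moreover have "(\<gamma> 0 /\<^sub>R r) \<bullet> (\<gamma> 1 /\<^sub>R r) = (V \<bullet> U) / r\<^sup>2"
      unfolding \<gamma>(2,3) inner_scaleR_left inner_scaleR_right
      by (simp add: divide_inverse power2_eq_square)
    ultimately show ?thesis by linarith
  qed
  also have "arccos (1 - 2 * ?y\<^sup>2) = 2 * arcsin ?y"
    by (rule two_arcsin[symmetric, OF y])
  finally have "2 * r * arcsin ?y \<le> integral {0..1} (\<lambda>t. norm (velocity \<gamma> t))"
    using r(1) by (simp add: pos_le_divide_eq mult_ac)
  then have "min 1 (sqrt \<beta>) * (2 * r * arcsin ?y)
      \<le> min 1 (sqrt \<beta>) * integral {0..1} (\<lambda>t. norm (velocity \<gamma> t))"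
    using \<beta> by (intro mult_left_mono) auto
  also have "\<dots> = integral {0..1} (\<lambda>t. min 1 (sqrt \<beta>) * norm (velocity \<gamma> t))" by simp
  also have "\<dots> \<le> beta_length \<beta> \<gamma>"
  proof -
    have cg: "continuous_on {0..1} \<gamma>"
      using c(1) has_vector_derivative_continuous continuous_on_eq_continuous_within by blast
    show ?thesis
      unfolding beta_length_def
    proof (rule integral_le)
      show "(\<lambda>t. beta_norm \<beta> (\<gamma> t) (velocity \<gamma> t)) integrable_on {0..1}"
        by (intro integrable_continuous_interval continuous_on_beta_norm cg c(2))
      show "(\<lambda>t. min 1 (sqrt \<beta>) * norm (velocity \<gamma> t)) integrable_on {0..1}"
        by (intro integrable_continuous_interval continuous_on_mult continuous_on_const
            continuous_on_norm c(2))
    qed (intro beta_norm_bounds(1) c(3) \<beta>)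
  qed
  finally show ?thesis by (simp add: m_hat_def r_def mult.assoc)
qed

theorem theorem7p1:
  fixes \<beta> :: real and U V :: "real^'p^'n"
  assumes "CARD('n) \<ge> 2 * CARD('p)"
    and "\<beta> > 0"
    and "U \<in> stiefel" and "V \<in> stiefel"
  shows "ereal (m_hat CARD('p) \<beta> (norm (V - U))) \<le> beta_dist \<beta> V U
    \<and> beta_dist \<beta> V U \<le> ereal (M_hat \<beta> (norm (V - U)))"
proof
  show "ereal (m_hat CARD('p) \<beta> (norm (V - U))) \<le> beta_dist \<beta> V U"
    unfolding beta_dist_def
    by (intro INF_greatest) (auto intro: m_hat_le_length assms(2))
  show "beta_dist \<beta> V U \<le> ereal (M_hat \<beta> (norm (V - U)))"
  \<comment> \<open>The infimum in \<open>frob_dist\<close> need not be attained, hence the slack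
    \<open>e\<close>; it is divided by \<open>?M\<close> because
    \<open>beta_dist_le_joinable\<close> multiplies lengths by that factor.\<close>
  proof (rule ereal_le_epsilon2)
    fix e :: real assume "e > 0"
    let ?M = "max 1 (sqrt \<beta>)"
    have "0 < e / ?M" using \<open>e > 0\<close> by (simp add: less_max_iff_disj)
    then have "frob_dist V U < M_hat 1 (norm (V - U)) + e / ?M"
      using frob_dist_M_hat[OF assms(1,4,3)] unfolding norm_minus_commute[of U V] by linarith
    then have "joinable V U (M_hat 1 (norm (V - U)) + e / ?M)"
      by (intro joinable_frob_dist[OF assms(1)] assms)
    from beta_dist_le_joinable[OF this assms(2)]
    have "beta_dist \<beta> V U \<le> ereal (?M * (M_hat 1 (norm (V - U)) + e / ?M))" .
    also have "?M * (M_hat 1 (norm (V - U)) + e / ?M) = M_hat \<beta> (norm (V - U)) + e"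
      by (simp add: M_hat_def distrib_left max_def)
    finally show "beta_dist \<beta> V U \<le> ereal (M_hat \<beta> (norm (V - U))) + ereal e" by simp
  qed
qed

end
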